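(* Suppose $f_0(t) = 2(1-t)\mathbf{1}_{[0,1]}(t)$ for $t\in[0,\infty)$, and let $\hat f_n$ be the convex least squares estimator of $f_0$ based on $n$ i.i.d. observations from $f_0$. Then for any fixed $x_0 \in (0,1)$, $$|\hat f_n(x_0) - f_0(x_0)| = O_p(n^{-1/2}) \quad\text{as } n\to\infty.$$
   Context: Let $\mathcal K$ be the convex cone of all non-negative, continuous, convex and integrable functions on $[0,\infty)$. Given $n$ i.i.d. observations from a density $f_0:[0,\infty)\to[0,\infty)$, with empirical distribution function $\mathbb F_n$, the convex least squares estimator (LSE) is $$\hat f_n = \operatorname*{argmin}_{g\in\mathcal K}\Big(\tfrac12\int_0^\infty g(t)^2\,dt - \int_0^\infty g(t)\,d\mathbb F_n(t)\Big).$$ *)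

theory Defs
  imports "HOL-Probability.Probability"
begin

(* Functions on [0,\<infinity>) are total functions on real of which only the values on {0..} are
   constrained and used. *)

definition convex_cone_K :: "(real \<Rightarrow> real) set" where
  "convex_cone_K = {g. (\<forall>t\<ge>0. 0 \<le> g t) \<and> continuous_on {0..} g \<and> convex_on {0..} g
                       \<and> set_integrable lborel {0..} g}"

(* A sample of size n consists of the values x 0, ..., x (n - 1). *)
definition empirical_cdf :: "nat \<Rightarrow> (nat \<Rightarrow> real) \<Rightarrow> real \<Rightarrow> real" where
  "empirical_cdf n x t = real (card {i \<in> {..<n}. x i \<le> t}) / real n"

(* interval_measure F is the Lebesgue-Stieltjes measure dF. *)
definition lse_criterion :: "nat \<Rightarrow> (nat \<Rightarrow> real) \<Rightarrow> (real \<Rightarrow> real) \<Rightarrow> real" where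
  "lse_criterion n x g =
     1 / 2 * (LBINT t:{0..}. (g t)\<^sup>2) - (LINT t:{0..}|interval_measure (empirical_cdf n x). g t)"

(* A predicate rather than a value of arg_min: for a sample containing the point 0 the criterion
   is unbounded below on the cone, and two minimisers may differ on the irrelevant half-line
   t < 0. *)
definition is_convex_lse :: "nat \<Rightarrow> (nat \<Rightarrow> real) \<Rightarrow> (real \<Rightarrow> real) \<Rightarrow> bool" where
  "is_convex_lse n x g \<longleftrightarrow> is_arg_min (lse_criterion n x) (\<lambda>h. h \<in> convex_cone_K) g"

(* Extended by 0 to the negative half-line, so that it is a density on the real line. *)
definition triangular_density :: "real \<Rightarrow> real" where
  "triangular_density t = 2 * (1 - t) * indicator {0..1} t"

(* The outer measure agrees with the probability on measurable events, i.e. whenever the Y n are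
   random variables; using it avoids that a non-measurable set gets the default measure 0. *)
definition bigO_in_prob :: "'a measure \<Rightarrow> (nat \<Rightarrow> 'a \<Rightarrow> real) \<Rightarrow> (nat \<Rightarrow> real) \<Rightarrow> bool" where
  "bigO_in_prob M Y r \<longleftrightarrow>
     (\<forall>\<epsilon>>0. \<exists>C. \<forall>\<^sub>F n in sequentially.
        outer_measure_of M {\<omega> \<in> space M. \<bar>Y n \<omega>\<bar> > C * r n} \<le> ennreal \<epsilon>)"

lemma interval_measure_empirical_cdf:
  assumes "n > 0"
  shows "interval_measure (empirical_cdf n x) = distr (uniform_count_measure {..<n}) borel x"
proof -
  let ?U = "uniform_count_measure {..<n}"
  let ?D = "distr ?U borel x"
  interpret U: prob_space ?U
    using assms by (intro prob_space_uniform_count_measure) auto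
  have meas: "x \<in> measurable ?U borel"
    by (auto simp: measurable_def sets_uniform_count_measure space_uniform_count_measure)
  interpret D: prob_space ?D
    by (rule U.prob_space_distr[OF meas])
  interpret D: real_distribution ?D
    by unfold_locales simp_all
  have F: "cdf ?D = empirical_cdf n x"
  proof
    fix t
    have "cdf ?D t = measure ?U (x -` {..t} \<inter> {..<n})"
      by (simp add: cdf_def measure_distr[OF meas] space_uniform_count_measure)
    also have "\<dots> = empirical_cdf n x t"
      by (subst measure_uniform_count_measure)
         (auto simp: empirical_cdf_def intro!: arg_cong[where f = card])
    finally show "cdf ?D t = empirical_cdf n x t" .
  qed
  have mono: "empirical_cdf n x s \<le> empirical_cdf n x t" if "s \<le> t" for s t
    unfolding F[symmetric] using D.cdf_nondecreasing that by auto
  have cont: "continuous (at_right a) (empirical_cdf n x)" for a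
    unfolding F[symmetric] by (rule D.cdf_is_right_cont)
  have bot: "(empirical_cdf n x \<longlongrightarrow> 0) at_bot"
    unfolding F[symmetric] by (rule D.cdf_lim_at_bot)
  have top: "(empirical_cdf n x \<longlongrightarrow> 1) at_top"
    unfolding F[symmetric] by (rule D.cdf_lim_at_top_prob)
  show ?thesis
  proof (rule cdf_unique)
    show "real_distribution (interval_measure (empirical_cdf n x))"
      by (rule real_distribution_interval_measure[OF mono cont bot top])
    show "real_distribution ?D"
      by unfold_locales
    show "cdf (interval_measure (empirical_cdf n x)) = cdf ?D"
      unfolding F by (rule cdf_interval_measure[OF mono cont bot])
  qed
qed

lemma lse_criterion_eq:
  assumes "n > 0" and nonneg: "\<And>i. i < n \<Longrightarrow> x i \<ge> 0" and "continuous_on {0..} g"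
  shows "lse_criterion n x g = 1 / 2 * (LBINT t:{0..}. (g t)\<^sup>2) - (\<Sum>i<n. g (x i)) / real n"
proof -
  have meas: "x \<in> measurable (uniform_count_measure {..<n}) borel"
    by (auto simp: measurable_def sets_uniform_count_measure space_uniform_count_measure)
  have g: "(\<lambda>t. indicator {0..} t *\<^sub>R g t) \<in> borel_measurable borel"
    using assms(3) by (intro borel_measurable_continuous_on_indicator) auto
  have "(LINT t:{0..}|interval_measure (empirical_cdf n x). g t) =
        (\<integral>i. indicator {0..} (x i) *\<^sub>R g (x i) \<partial>uniform_count_measure {..<n})"
    unfolding set_lebesgue_integral_def interval_measure_empirical_cdf[OF assms(1)]
    by (rule integral_distr[OF meas g])
  also have "\<dots> = (\<Sum>i<n. indicator {0..} (x i) *\<^sub>R g (x i)) / real n"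
  proof -
    have "(\<integral>i. h i \<partial>uniform_count_measure {..<n}) = (\<Sum>i<n. h i) / real n" for h :: "nat \<Rightarrow> real"
      unfolding uniform_count_measure_def
      by (subst lebesgue_integral_point_measure_finite) (simp_all add: sum_divide_distrib)
    then show ?thesis .
  qed
  also have "(\<Sum>i<n. indicator {0..} (x i) *\<^sub>R g (x i)) = (\<Sum>i<n. g (x i))"
    using nonneg by (intro sum.cong) auto
  finally show ?thesis
    by (simp add: lse_criterion_def)
qed

end

theory Submission
  imports Defs
begin

text \<open>
  The difference \<open>h = f - f\<^sub>0\<close> between the estimator and the truth is convex on \<open>[0,1]\<close>, because
  \<open>f\<^sub>0\<close> is affine there. Testing the minimality of \<open>f\<close> against \<open>f\<^sub>0\<close> itself gives
  \<open>\<integral> h\<^sup>2 \<le> \<integral> h d(P\<^sub>n - P)\<close>, but this global inequality is spoilt by the endpoints, where \<open>h\<close> may be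
  large and steep. It is therefore localised: \<open>h\<close> is replaced by \<open>u t = h (max a (min t c))\<close>,
  constant outside an interval \<open>[a,c]\<close> around \<open>x\<^sub>0\<close>. The cut points \<open>a\<close> and \<open>c\<close> depend on \<open>h\<close>; they
  are minimisers or zeros of \<open>h\<close> to the left and to the right of \<open>x\<^sub>0\<close>, or endpoints of \<open>[0,1]\<close>
  (\<open>ex_left_cut_point\<close>, \<open>ex_right_cut_point\<close>). This choice makes three things true at once.

  First, \<open>f - u\<close> agrees on \<open>[0,1]\<close> with a member of the cone that is dominated by \<open>f\<close> beyond 1
  (\<open>clamped_comparison_function\<close>), so that minimality yields \<open>\<integral> u h \<le> \<integral> u d(P\<^sub>n - P)\<close>. Second,
  \<open>u\<^sup>2 \<le> u h\<close>, so the left-hand side dominates the squared \<open>L\<^sup>2\<close> norm of \<open>u\<close>. Third, this norm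
  dominates the supremum of \<open>\<bar>u\<bar>\<close> up to a constant depending on \<open>x\<^sub>0\<close> only
  (\<open>clamped_convex_sup_le_L2\<close>).

  On the other side, \<open>u\<close> has intervals as sublevel sets, so \<open>\<integral> u d(P\<^sub>n - P)\<close> is at most
  \<open>4 * sup \<bar>u\<bar> * sup \<bar>F\<^sub>n - F\<bar>\<close> (\<open>expectation_diff_le_cdf_diff\<close>). Cancelling one factor,
  \<open>\<bar>h x\<^sub>0\<bar> = \<bar>u x\<^sub>0\<bar>\<close> is bounded by a constant times \<open>sup \<bar>F\<^sub>n - F\<bar>\<close>, with no exceptional set
  (\<open>lse_pointwise_le_discrepancy\<close>).

  It remains that \<open>sup \<bar>F\<^sub>n - F\<bar>\<close> is of order \<open>n\<^sup>-\<^sup>1\<^sup>/\<^sup>2\<close> in probability, without a logarithm. This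
  follows from a Kolmogorov-type maximal inequality for the martingale
  \<open>(F\<^sub>n(t) - F(t)) / (1 - F(t))\<close> in \<open>t\<close> (\<open>nested_deviation_maximal\<close>,
  \<open>uniform_empirical_deviation\<close>).
\<close>

section \<open>A maximal inequality for nested sets\<close>

text \<open>
  Wherever \<open>\<xi> (X i)\<close> is nonzero, \<open>\<Psi>\<close> may be evaluated with the \<open>i\<close>-th coordinate replaced by
  the constant \<open>a\<close>, hence as a function of the other coordinates alone. By independence the
  expectation factors and the centred factor \<open>\<xi> (X i)\<close> annihilates it. This does the work of a
  conditional expectation given the past in the next proof.
\<close>

lemma (in prob_space) expectation_mult_eq_0_resample:
  fixes X :: "'i \<Rightarrow> 'a \<Rightarrow> real" and K L :: real
  assumes indep: "indep_vars (\<lambda>_. borel) X I" and i: "i \<in> I"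
    and meas[measurable]: "\<Psi> \<in> borel_measurable (PiM I (\<lambda>_. borel))" "\<xi> \<in> borel_measurable borel"
    and bound: "\<And>y. \<bar>\<Psi> y\<bar> \<le> K" "\<And>x. \<bar>\<xi> x\<bar> \<le> L"
    and mean: "expectation (\<lambda>\<omega>. \<xi> (X i \<omega>)) = 0"
    and resample: "\<And>y. \<xi> (y i) \<noteq> 0 \<Longrightarrow> \<Psi> (y(i := a)) = \<Psi> y"
  shows "expectation (\<lambda>\<omega>. \<Psi> (\<lambda>j\<in>I. X j \<omega>) * \<xi> (X i \<omega>)) = 0"
proof -
  define J where "J = I - {i}"
  let ?\<Phi> = "\<lambda>y. \<Psi> (y(i := a))"
  have I: "I = J \<union> {i}" and "i \<notin> J"
    using i by (auto simp: J_def)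
  have upd: "(\<lambda>y. y(i := a)) \<in> measurable (PiM J (\<lambda>_. borel)) (PiM I (\<lambda>_. borel))"
    by (rule measurable_fun_upd[OF I]) auto
  have \<Phi>[measurable]: "?\<Phi> \<in> borel_measurable (PiM J (\<lambda>_. borel))"
    using measurable_comp[OF upd meas(1)] by (simp add: comp_def)
  have Xm[measurable]: "X j \<in> borel_measurable M" if "j \<in> I" for j
    using indep that by (auto simp: indep_vars_def)
  have "indep_var (PiM J (\<lambda>_. borel)) (\<lambda>\<omega>. \<lambda>j\<in>J. X j \<omega>)
          (PiM {i} (\<lambda>_. borel)) (\<lambda>\<omega>. \<lambda>j\<in>{i}. X j \<omega>)"
    using indep_var_restrict[OF indep, of J "{i}"] i by (auto simp: J_def)
  then have "indep_var borel (?\<Phi> \<circ> (\<lambda>\<omega>. \<lambda>j\<in>J. X j \<omega>))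
          borel ((\<lambda>y. \<xi> (y i)) \<circ> (\<lambda>\<omega>. \<lambda>j\<in>{i}. X j \<omega>))"
    by (rule indep_var_compose) measurable
  then have ind: "indep_var borel (\<lambda>\<omega>. ?\<Phi> (\<lambda>j\<in>J. X j \<omega>)) borel (\<lambda>\<omega>. \<xi> (X i \<omega>))"
    by (simp add: comp_def)
  have m1: "(\<lambda>\<omega>. ?\<Phi> (\<lambda>j\<in>J. X j \<omega>)) \<in> borel_measurable M"
    using ind by (simp add: indep_var_rv1)
  have m2: "(\<lambda>\<omega>. \<xi> (X i \<omega>)) \<in> borel_measurable M"
    using ind by (simp add: indep_var_rv2)
  have "integrable M (\<lambda>\<omega>. ?\<Phi> (\<lambda>j\<in>J. X j \<omega>))" "integrable M (\<lambda>\<omega>. \<xi> (X i \<omega>))"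
    using integrable_const_bound[OF _ m1, of K] integrable_const_bound[OF _ m2, of L] bound by auto
  then have "expectation (\<lambda>\<omega>. ?\<Phi> (\<lambda>j\<in>J. X j \<omega>) * \<xi> (X i \<omega>)) = 0"
    using indep_var_lebesgue_integral[OF ind] mean by simp
  moreover have "\<Psi> (\<lambda>j\<in>I. X j \<omega>) * \<xi> (X i \<omega>) = ?\<Phi> (\<lambda>j\<in>J. X j \<omega>) * \<xi> (X i \<omega>)" for \<omega>
  proof (cases "\<xi> (X i \<omega>) = 0")
    case False
    have "(\<lambda>j\<in>J. X j \<omega>)(i := a) = (\<lambda>j\<in>I. X j \<omega>)(i := a)"
      by (auto simp: J_def fun_eq_iff)
    then show ?thesis
      using resample[of "\<lambda>j\<in>I. X j \<omega>"] False i by simp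
  qed simp
  ultimately show ?thesis by (simp only:)
qed

text \<open>
  For growing sets \<open>B k\<close> of probability \<open>p k\<close>, the normalised deviations
  \<open>(1\<^bsub>B k\<^esub>(X) - p k) / (1 - p k)\<close> form a martingale in \<open>k\<close>: the value is frozen at 1 once \<open>X\<close> has
  been caught by the sets, and the observations not yet caught have the law of \<open>X\<close> given
  \<open>X \<notin> B k\<close>. Kolmogorov's first-passage argument then bounds the largest of the \<open>N + 1\<close> deviations
  by the second moment of the last one alone. The bound is free of \<open>N\<close>, whereas a union bound would
  lose a logarithm.
\<close>

lemma (in prob_space) nested_deviation_maximal:
  fixes X :: "nat \<Rightarrow> 'a \<Rightarrow> real" and B :: "nat \<Rightarrow> real set"
  assumes indep: "indep_vars (\<lambda>_. borel) X {..<n}"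
    and B[measurable]: "\<And>k. B k \<in> sets borel" and mono: "\<And>j k. j \<le> k \<Longrightarrow> B j \<subseteq> B k"
    and p: "\<And>i k. i < n \<Longrightarrow> prob {\<omega> \<in> space M. X i \<omega> \<in> B k} = p k"
    and pr: "\<And>k. p k \<le> r" and r: "r < 1" and l: "0 < l"
  shows "prob {\<omega> \<in> space M. \<exists>k\<le>N. l \<le> \<bar>\<Sum>i<n. indicator (B k) (X i \<omega>) - p k\<bar>}
         \<le> r / (1 - r) * n / l\<^sup>2"
proof (cases "n = 0")
  case True
  then show ?thesis using l by simp
next
  case False
  then have n: "n > 0" by simp
  have Xm[measurable]: "X i \<in> borel_measurable M" if "i < n" for i
    using indep that by (auto simp: indep_vars_def)
  have p0: "0 \<le> p k" for k
    using p[OF n, of k] by (metis measure_nonneg)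
  have r0: "0 \<le> r"
    using p0 pr order_trans by blast
  have p1: "p k < 1" for k
    using pr r by (rule le_less_trans)
  define \<zeta> where "\<zeta> k x = 1 - indicator (- B k) x / (1 - p k)" for k and x :: real
  have \<zeta>m[measurable]: "\<zeta> k \<in> borel_measurable borel" for k
    unfolding \<zeta>_def by measurable
  have \<zeta>_eq: "\<zeta> k x = (indicator (B k) x - p k) / (1 - p k)" for k x
    using p1[of k] by (auto simp: \<zeta>_def indicator_def field_simps)
  \<comment> \<open>A crude bound whose only use is to make everything integrable.\<close>
  define L where "L = 1 + 1 / (1 - r)"
  have \<zeta>_bound: "\<bar>\<zeta> k x\<bar> \<le> L" for k x
  proof -
    have "1 / (1 - p k) \<le> 1 / (1 - r)"
      using p1[of k] pr[of k] r by (intro divide_left_mono) auto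
    moreover have "0 \<le> 1 / (1 - p k)" "0 \<le> 1 / (1 - r)"
      using p1[of k] r by simp_all
    ultimately have "\<bar>1 - 1 / (1 - p k)\<bar> \<le> L" "\<bar>1 :: real\<bar> \<le> L"
      unfolding L_def by linarith+
    then show ?thesis unfolding \<zeta>_def by (cases "x \<in> B k") auto
  qed
  have L0: "0 \<le> L" using r by (simp add: L_def)
  have ind_mean: "expectation (\<lambda>\<omega>. indicator (B k) (X i \<omega>)) = p k" if "i < n" for i k
  proof -
    have "expectation (\<lambda>\<omega>. indicator (B k) (X i \<omega>)) =
          expectation (indicat_real {\<omega> \<in> space M. X i \<omega> \<in> B k})"
      by (intro Bochner_Integration.integral_cong) (auto simp: indicator_def)
    also have "\<dots> = p k"
      using p[OF that, of k] by (simp add: Int_absorb2)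
    finally show ?thesis .
  qed
  have ind_int: "integrable M (\<lambda>\<omega>. indicator (B k) (X i \<omega>) :: real)" if "i < n" for i k
    using that by (intro integrable_const_bound[where B=1]) (auto simp: indicator_def)
  have \<zeta>_int: "integrable M (\<lambda>\<omega>. \<zeta> k (X i \<omega>))" if "i < n" for i k
    using that \<zeta>_bound by (intro integrable_const_bound[where B=L]) auto
  have \<zeta>_mean: "expectation (\<lambda>\<omega>. \<zeta> k (X i \<omega>)) = 0" if "i < n" for i k
    unfolding \<zeta>_eq using ind_mean[OF that] ind_int[OF that] by (simp add: prob_space)
  have \<zeta>_sq: "expectation (\<lambda>\<omega>. (\<zeta> k (X i \<omega>))\<^sup>2) = p k / (1 - p k)" if "i < n" for i k
  proof -
    have "(\<zeta> k x)\<^sup>2 = (indicator (B k) x * (1 - 2 * p k) + (p k)\<^sup>2) / (1 - p k)\<^sup>2" for x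
      by (auto simp: \<zeta>_eq indicator_def power_divide power2_eq_square algebra_simps)
    then have "expectation (\<lambda>\<omega>. (\<zeta> k (X i \<omega>))\<^sup>2) = (p k * (1 - 2 * p k) + (p k)\<^sup>2) / (1 - p k)\<^sup>2"
      using ind_mean[OF that] ind_int[OF that] by (simp add: prob_space)
    also have "\<dots> = p k / (1 - p k)"
      using p1[of k] by (simp add: power2_eq_square divide_simps) (simp add: algebra_simps)
    finally show ?thesis .
  qed
  define S where "S k y = (\<Sum>i<n. \<zeta> k (y i))" for k and y :: "nat \<Rightarrow> real"
  define A where "A k y \<longleftrightarrow> l \<le> \<bar>S k y\<bar> \<and> (\<forall>m<k. \<bar>S m y\<bar> < l)" for k y
  let ?P = "PiM {..<n} (\<lambda>_. borel :: real measure)"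
  let ?X = "\<lambda>\<omega>. \<lambda>i\<in>{..<n}. X i \<omega>"
  have Sm[measurable]: "S k \<in> borel_measurable ?P" for k
    unfolding S_def by measurable
  have Am[measurable]: "Measurable.pred ?P (A k)" for k
    unfolding A_def by measurable
  have XP[measurable]: "?X \<in> measurable M ?P"
    by measurable
  have S_bound: "\<bar>S k y\<bar> \<le> n * L" for k y
  proof -
    have "\<bar>S k y\<bar> \<le> (\<Sum>i<n. \<bar>\<zeta> k (y i)\<bar>)"
      unfolding S_def by (rule sum_abs)
    also have "\<dots> \<le> (\<Sum>i<n. L)"
      by (intro sum_mono \<zeta>_bound)
    finally show ?thesis by simp
  qed
  have int: "integrable M (\<lambda>\<omega>. f (?X \<omega>))" if "f \<in> borel_measurable ?P" "\<And>y. \<bar>f y\<bar> \<le> K"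
    for f :: "(nat \<Rightarrow> real) \<Rightarrow> real" and K
    using measurable_compose[OF XP that(1)] that(2)
    by (intro integrable_const_bound[where B=K]) auto
  have S_ind_bound: "\<bar>S k y * of_bool (A m y)\<bar> \<le> n * L" for k m y
    using S_bound[of k y] L0 by (auto simp: of_bool_def)
  have nL: "0 \<le> n * L" using L0 by simp
  have SS_bound: "\<bar>S j y * S k y * of_bool (A m y)\<bar> \<le> (n * L) * (n * L)" for j k m y
    using mult_mono[OF S_bound[of j y] S_bound[of k y]] nL by (auto simp: of_bool_def abs_mult)
  have SS_bound': "\<bar>S j y * S k y\<bar> \<le> (n * L) * (n * L)" for j k y
    using mult_mono[OF S_bound[of j y] S_bound[of k y]] nL by (auto simp: abs_mult)
  \<comment> \<open>The martingale property: on \<open>B k\<close> the later increment is zero, and off \<open>B k\<close> the sums up to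
    index \<open>k\<close> only see that the observation avoids \<open>B k\<close>, so any point outside may stand for it.\<close>
  have orth: "expectation (\<lambda>\<omega>. S k (?X \<omega>) * of_bool (A k (?X \<omega>)) * (S N (?X \<omega>) - S k (?X \<omega>))) = 0"
    if "k \<le> N" for k
  proof -
    have "- B k \<noteq> {}"
    proof
      assume "- B k = {}"
      then have "B k = UNIV" by auto
      then show False using p[OF n, of k] p1[of k] by (simp add: prob_space)
    qed
    then obtain a where a: "a \<notin> B k" by auto
    define \<xi> where "\<xi> x = \<zeta> N x - \<zeta> k x" for x
    have \<xi>0: "\<xi> x = 0" if "x \<in> B k" for x
      using that mono[OF \<open>k \<le> N\<close>] by (auto simp: \<xi>_def \<zeta>_def)
    have same: "\<zeta> j x = \<zeta> j a" if "j \<le> k" "x \<notin> B k" for j x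
      using that mono[OF \<open>j \<le> k\<close>] a by (auto simp: \<zeta>_def indicator_def)
    have S_same: "S j (y(i := a)) = S j y" if "j \<le> k" "\<xi> (y i) \<noteq> 0" for i j y
    proof -
      have "\<zeta> j a = \<zeta> j (y i)"
        using same[OF \<open>j \<le> k\<close>, of "y i"] \<xi>0 that(2) by force
      then show ?thesis
        unfolding S_def by (intro sum.cong) auto
    qed
    have *: "expectation (\<lambda>\<omega>. S k (?X \<omega>) * of_bool (A k (?X \<omega>)) * \<xi> (X i \<omega>)) = 0" if "i < n" for i
    proof (rule expectation_mult_eq_0_resample[OF indep, where K="n * L" and L="2 * L" and a=a])
      show "(\<lambda>y. S k y * of_bool (A k y)) \<in> borel_measurable ?P" by measurable
      show "\<xi> \<in> borel_measurable borel" unfolding \<xi>_def by measurable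
      show "\<bar>S k y * of_bool (A k y)\<bar> \<le> n * L" for y by (rule S_ind_bound)
      show "\<bar>\<xi> x\<bar> \<le> 2 * L" for x
        using \<zeta>_bound[of N x] \<zeta>_bound[of k x] by (simp add: \<xi>_def)
      show "expectation (\<lambda>\<omega>. \<xi> (X i \<omega>)) = 0"
        unfolding \<xi>_def using \<zeta>_int[OF that] \<zeta>_mean[OF that] by simp
      show "S k (y(i := a)) * of_bool (A k (y(i := a))) = S k y * of_bool (A k y)"
        if "\<xi> (y i) \<noteq> 0" for y
      proof -
        have "S j (y(i := a)) = S j y" if "j \<le> k" for j
          using that \<open>\<xi> (y i) \<noteq> 0\<close> by (rule S_same)
        then show ?thesis
          unfolding A_def by simp
      qed
    qed (use that in auto)
    have "S k (?X \<omega>) * of_bool (A k (?X \<omega>)) * (S N (?X \<omega>) - S k (?X \<omega>)) =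
          (\<Sum>i<n. S k (?X \<omega>) * of_bool (A k (?X \<omega>)) * \<xi> (X i \<omega>))" for \<omega>
    proof -
      have "S N (?X \<omega>) - S k (?X \<omega>) = (\<Sum>i<n. \<xi> (X i \<omega>))"
        by (simp add: S_def \<xi>_def sum_subtractf)
      then show ?thesis
        by (simp only: sum_distrib_left)
    qed
    moreover have "integrable M (\<lambda>\<omega>. S k (?X \<omega>) * of_bool (A k (?X \<omega>)) * \<xi> (X i \<omega>))"
      if "i < n" for i
    proof -
      have "integrable M (\<lambda>\<omega>. (\<lambda>y. S k y * of_bool (A k y) * \<xi> (y i)) (?X \<omega>))"
      proof (rule int[of _ "n * L * (2 * L)"])
        show "(\<lambda>y. S k y * of_bool (A k y) * \<xi> (y i)) \<in> borel_measurable ?P"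
        proof -
          have [measurable]: "(\<lambda>y. \<zeta> j (y i)) \<in> borel_measurable ?P" for j
            by (rule measurable_compose[of "\<lambda>y. y i" ?P borel])
               (use that measurable_component_singleton[of i "{..<n}" "\<lambda>_. borel"] in auto)
          show ?thesis
            unfolding \<xi>_def by measurable
        qed
        show "\<bar>S k y * of_bool (A k y) * \<xi> (y i)\<bar> \<le> n * L * (2 * L)" for y
          unfolding abs_mult[of "S k y * of_bool (A k y)"]
          using \<zeta>_bound[of N "y i"] \<zeta>_bound[of k "y i"] nL
          by (intro mult_mono[OF S_ind_bound]) (auto simp: \<xi>_def)
      qed
      then show ?thesis using that by simp
    qed
    ultimately show ?thesis using * by simp
  qed
  have first: "l\<^sup>2 * prob {\<omega> \<in> space M. A k (?X \<omega>)} \<le>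
      expectation (\<lambda>\<omega>. (S N (?X \<omega>))\<^sup>2 * of_bool (A k (?X \<omega>)))" if "k \<le> N" for k
  proof -
    have i1: "integrable M (\<lambda>\<omega>. S j (?X \<omega>) * S m (?X \<omega>) * of_bool (A k (?X \<omega>)))" for j m
      by (rule int[of "\<lambda>y. S j y * S m y * of_bool (A k y)", OF _ SS_bound]) measurable
    have "l\<^sup>2 * prob {\<omega> \<in> space M. A k (?X \<omega>)} = expectation (\<lambda>\<omega>. l\<^sup>2 * of_bool (A k (?X \<omega>)))"
    proof -
      have "expectation (\<lambda>\<omega>. of_bool (A k (?X \<omega>))) = expectation (indicat_real {\<omega> \<in> space M. A k (?X \<omega>)})"
        by (intro Bochner_Integration.integral_cong) (auto simp: indicator_def)
      then show ?thesis by simp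
    qed
    \<comment> \<open>On the event, \<open>l\<^sup>2 \<le> (S k)\<^sup>2 + (S N - S k)\<^sup>2 = (S N)\<^sup>2 - 2 * S k * (S N - S k)\<close>, and the
      last product has expectation zero.\<close>
    also have "\<dots> \<le> expectation (\<lambda>\<omega>. S N (?X \<omega>) * S N (?X \<omega>) * of_bool (A k (?X \<omega>))
         - 2 * (S k (?X \<omega>) * S N (?X \<omega>) * of_bool (A k (?X \<omega>)) - S k (?X \<omega>) * S k (?X \<omega>) * of_bool (A k (?X \<omega>))))"
    proof (rule integral_mono)
      show "integrable M (\<lambda>\<omega>. l\<^sup>2 * of_bool (A k (?X \<omega>)))"
        by (rule int[of "\<lambda>y. l\<^sup>2 * of_bool (A k y)" "l\<^sup>2"]) (auto simp: of_bool_def)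
      fix \<omega>
      let ?y = "?X \<omega>"
      have "l\<^sup>2 \<le> (S k ?y)\<^sup>2 + (S N ?y - S k ?y)\<^sup>2" if "A k ?y"
      proof -
        have "l\<^sup>2 \<le> \<bar>S k ?y\<bar>\<^sup>2"
          using that l unfolding A_def by (intro power_mono) auto
        then show ?thesis using zero_le_power2[of "S N ?y - S k ?y"] by (simp only: power2_abs)
      qed
      then show "l\<^sup>2 * of_bool (A k ?y) \<le> S N ?y * S N ?y * of_bool (A k ?y)
         - 2 * (S k ?y * S N ?y * of_bool (A k ?y) - S k ?y * S k ?y * of_bool (A k ?y))"
        by (auto simp: of_bool_def power2_eq_square algebra_simps)
    qed (intro Bochner_Integration.integrable_diff integrable_mult_right i1)+
    also have "\<dots> = expectation (\<lambda>\<omega>. S N (?X \<omega>) * S N (?X \<omega>) * of_bool (A k (?X \<omega>)))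
      - 2 * expectation (\<lambda>\<omega>. S k (?X \<omega>) * S N (?X \<omega>) * of_bool (A k (?X \<omega>)) - S k (?X \<omega>) * S k (?X \<omega>) * of_bool (A k (?X \<omega>)))"
      by (subst Bochner_Integration.integral_diff)
         (intro Bochner_Integration.integrable_diff integrable_mult_right i1
          | simp only: integral_mult_right_zero)+
    also have "expectation (\<lambda>\<omega>. S k (?X \<omega>) * S N (?X \<omega>) * of_bool (A k (?X \<omega>)) - S k (?X \<omega>) * S k (?X \<omega>) * of_bool (A k (?X \<omega>))) = 0"
      using orth[OF that] by (simp only: algebra_simps)
    finally show ?thesis by (simp only: power2_eq_square mult_zero_right diff_zero)
  qed
  have second_moment: "expectation (\<lambda>\<omega>. (S N (?X \<omega>))\<^sup>2) \<le> n * (r / (1 - r))"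
  proof -
    have pair0: "expectation (\<lambda>\<omega>. \<zeta> N (X i \<omega>) * \<zeta> N (X j \<omega>)) = 0" if "i < n" "j < n" "i \<noteq> j" for i j
    proof -
      have "expectation (\<lambda>\<omega>. (\<lambda>y. \<zeta> N (y i)) (?X \<omega>) * \<zeta> N (X j \<omega>)) = 0"
        by (rule expectation_mult_eq_0_resample[OF indep, where K=L and L=L])
          (use that \<zeta>_bound \<zeta>_mean in auto)
      then show ?thesis using that by simp
    qed
    have pair_int: "integrable M (\<lambda>\<omega>. \<zeta> N (X i \<omega>) * \<zeta> N (X j \<omega>))" if "i < n" "j < n" for i j
      using that mult_mono[OF \<zeta>_bound \<zeta>_bound] L0
      by (intro integrable_const_bound[where B="L * L"]) (auto simp: abs_mult)
    have "expectation (\<lambda>\<omega>. (S N (?X \<omega>))\<^sup>2) =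
          expectation (\<lambda>\<omega>. \<Sum>i<n. \<Sum>j<n. \<zeta> N (X i \<omega>) * \<zeta> N (X j \<omega>))"
      by (simp add: S_def power2_eq_square sum_product)
    also have "\<dots> = (\<Sum>i<n. expectation (\<lambda>\<omega>. \<Sum>j<n. \<zeta> N (X i \<omega>) * \<zeta> N (X j \<omega>)))"
      by (rule Bochner_Integration.integral_sum) (auto intro!: Bochner_Integration.integrable_sum pair_int)
    also have "\<dots> = (\<Sum>i<n. \<Sum>j<n. expectation (\<lambda>\<omega>. \<zeta> N (X i \<omega>) * \<zeta> N (X j \<omega>)))"
      by (intro sum.cong refl Bochner_Integration.integral_sum) (auto intro!: pair_int)
    also have "\<dots> = (\<Sum>i<n. \<Sum>j<n. if j = i then p N / (1 - p N) else 0)"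
      using \<zeta>_sq pair0 by (intro sum.cong) (auto simp: power2_eq_square)
    also have "\<dots> = n * (p N / (1 - p N))"
      by (simp add: sum.delta)
    also have "\<dots> \<le> n * (r / (1 - r))"
      using pr[of N] p1[of N] p0[of N] r r0 by (intro mult_left_mono frac_le) auto
    finally show ?thesis .
  qed
  have disj: "disjoint_family_on (\<lambda>k. {\<omega> \<in> space M. A k (?X \<omega>)}) {..N}"
    unfolding disjoint_family_on_def A_def by (auto, metis linorder_neqE_nat not_less)
  have "{\<omega> \<in> space M. \<exists>k\<le>N. l \<le> \<bar>\<Sum>i<n. indicator (B k) (X i \<omega>) - p k\<bar>} \<subseteq>
        (\<Union>k\<le>N. {\<omega> \<in> space M. A k (?X \<omega>)})"
  proof
    fix \<omega> assume "\<omega> \<in> {\<omega> \<in> space M. \<exists>k\<le>N. l \<le> \<bar>\<Sum>i<n. indicator (B k) (X i \<omega>) - p k\<bar>}"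
    then obtain k where k: "k \<le> N" "l \<le> \<bar>\<Sum>i<n. indicator (B k) (X i \<omega>) - p k\<bar>" and \<omega>: "\<omega> \<in> space M"
      by auto
    have "S k (?X \<omega>) = (\<Sum>i<n. indicator (B k) (X i \<omega>) - p k) / (1 - p k)"
      by (simp add: S_def \<zeta>_eq sum_divide_distrib)
    then have "(\<Sum>i<n. indicator (B k) (X i \<omega>) - p k) = S k (?X \<omega>) * (1 - p k)"
      using p1[of k] by simp
    then have "\<bar>\<Sum>i<n. indicator (B k) (X i \<omega>) - p k\<bar> \<le> \<bar>S k (?X \<omega>)\<bar>"
      using p0[of k] p1[of k] by (simp add: abs_mult mult_left_le)
    then have ex: "l \<le> \<bar>S k (?X \<omega>)\<bar>" using k by simp
    define m where "m = (LEAST m. l \<le> \<bar>S m (?X \<omega>)\<bar>)"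
    have "A m (?X \<omega>)" "m \<le> k"
      unfolding A_def m_def using LeastI[of "\<lambda>m. l \<le> \<bar>S m (?X \<omega>)\<bar>", OF ex] ex
      by (auto intro: Least_le dest: not_less_Least simp: not_le[symmetric])
    then show "\<omega> \<in> (\<Union>k\<le>N. {\<omega> \<in> space M. A k (?X \<omega>)})"
      using \<omega> k by auto
  qed
  then have "l\<^sup>2 * prob {\<omega> \<in> space M. \<exists>k\<le>N. l \<le> \<bar>\<Sum>i<n. indicator (B k) (X i \<omega>) - p k\<bar>} \<le>
      l\<^sup>2 * prob (\<Union>k\<le>N. {\<omega> \<in> space M. A k (?X \<omega>)})"
    by (intro mult_left_mono finite_measure_mono) auto
  also have "prob (\<Union>k\<le>N. {\<omega> \<in> space M. A k (?X \<omega>)}) = (\<Sum>k\<le>N. prob {\<omega> \<in> space M. A k (?X \<omega>)})"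
    using disj by (intro finite_measure_finite_Union) auto
  also have "l\<^sup>2 * \<dots> \<le> (\<Sum>k\<le>N. expectation (\<lambda>\<omega>. (S N (?X \<omega>))\<^sup>2 * of_bool (A k (?X \<omega>))))"
    unfolding sum_distrib_left by (intro sum_mono first) auto
  also have "\<dots> = expectation (\<lambda>\<omega>. \<Sum>k\<le>N. (S N (?X \<omega>))\<^sup>2 * of_bool (A k (?X \<omega>)))"
    by (rule Bochner_Integration.integral_sum[symmetric],
        rule int[of "\<lambda>y. (S N y)\<^sup>2 * of_bool (A _ y)" "(n * L) * (n * L)"])
       (use SS_bound[of N _ N] in \<open>auto simp: power2_eq_square\<close>)
  also have "\<dots> \<le> expectation (\<lambda>\<omega>. (S N (?X \<omega>))\<^sup>2)"
  proof (rule integral_mono)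
    show "integrable M (\<lambda>\<omega>. \<Sum>k\<le>N. (S N (?X \<omega>))\<^sup>2 * of_bool (A k (?X \<omega>)))"
      by (intro Bochner_Integration.integrable_sum int[of "\<lambda>y. (S N y)\<^sup>2 * of_bool (A _ y)" "(n * L) * (n * L)"])
         (use SS_bound[of N _ N] in \<open>auto simp: power2_eq_square\<close>)
    show "integrable M (\<lambda>\<omega>. (S N (?X \<omega>))\<^sup>2)"
      by (rule int[of "\<lambda>y. (S N y)\<^sup>2" "(n * L) * (n * L)"])
         (use SS_bound'[of N _ N] in \<open>auto simp: power2_eq_square\<close>)
    fix \<omega> assume \<omega>: "\<omega> \<in> space M"
    have "(\<Sum>k\<le>N. of_bool (A k (?X \<omega>)) :: real) \<le> 1"
    proof (cases "\<exists>m\<le>N. A m (?X \<omega>)")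
      case True
      then obtain m where m: "m \<le> N" "A m (?X \<omega>)" by auto
      have "(\<Sum>k\<le>N. of_bool (A k (?X \<omega>)) :: real) = (\<Sum>k\<le>N. if k = m then 1 else 0)"
        using disj m \<omega> unfolding disjoint_family_on_def by (intro sum.cong) (auto simp: of_bool_def)
      then show ?thesis using m by simp
    qed auto
    then have "(S N (?X \<omega>))\<^sup>2 * (\<Sum>k\<le>N. of_bool (A k (?X \<omega>))) \<le> (S N (?X \<omega>))\<^sup>2 * 1"
      by (intro mult_left_mono) auto
    then show "(\<Sum>k\<le>N. (S N (?X \<omega>))\<^sup>2 * of_bool (A k (?X \<omega>))) \<le> (S N (?X \<omega>))\<^sup>2"
      by (simp only: sum_distrib_left mult_1_right)
  qed
  also note second_moment
  finally show ?thesis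
    unfolding pos_le_divide_eq[OF zero_less_power[OF l, of 2]] by (simp only: mult.commute)
qed

section \<open>Uniform deviation of the empirical distribution\<close>

lemma (in real_distribution) ex_quantile:
  assumes cont: "\<And>x. isCont (cdf M) x" and u: "0 < u" "u < 1"
  shows "\<exists>x. cdf M x = u"
proof -
  have "\<forall>\<^sub>F x in at_bot. cdf M x < u" "\<forall>\<^sub>F x in at_top. u < cdf M x"
    using order_tendstoD(2)[OF cdf_lim_at_bot u(1)] order_tendstoD(1)[OF cdf_lim_at_top_prob u(2)] .
  then obtain a b where ab: "\<And>x. x \<le> a \<Longrightarrow> cdf M x < u" "\<And>x. b \<le> x \<Longrightarrow> u < cdf M x"
    unfolding eventually_at_bot_linorder eventually_at_top_linorder by auto
  have "cdf M (min a b) < u" "u < cdf M (max a b)"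
    using ab by auto
  then show ?thesis
    using IVT[of "cdf M" "min a b" u "max a b"] cont by force
qed

text \<open>
  The empirical distribution function is uniformly within order \<open>1 / sqrt n\<close> of a continuous
  distribution function. Both functions are monotone, so it suffices to compare them at the
  \<open>k / n\<close>-quantiles, at a cost of \<open>1 / n\<close>. The maximal inequality is applied twice, to lower
  half-lines up to the median and to upper half-lines down to it: its constant
  \<open>r / (1 - r)\<close> degenerates when the sets exhaust the whole line. The conclusion is phrased with
  an exceptional event, and also for open half-lines, so that closed intervals can be treated later.
\<close>

lemma (in prob_space) uniform_empirical_deviation:
  fixes X :: "nat \<Rightarrow> 'a \<Rightarrow> real"
  assumes indep: "indep_vars (\<lambda>_. borel) X {..<n}" and n: "0 < n" and l: "0 < l"
    and D: "real_distribution D" and dist: "\<And>i. i < n \<Longrightarrow> distr M borel (X i) = D"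
    and no_atom: "\<And>x. measure D {x} = 0"
  shows "\<exists>E\<in>events. prob E \<le> 2 / l\<^sup>2 \<and> (\<forall>\<omega>\<in>space M - E. \<forall>A. \<forall>t::real. A = {..t} \<or> A = {..<t} \<longrightarrow>
           \<bar>(\<Sum>i<n. indicator A (X i \<omega>)) / n - measure D A\<bar> \<le> l / sqrt n + 1 / n)"
proof -
  interpret D: real_distribution D by (rule D)
  have Xm[measurable]: "X i \<in> borel_measurable M" if "i < n" for i
    using indep that by (auto simp: indep_vars_def)
  have prob_eq: "prob {\<omega> \<in> space M. X i \<omega> \<in> A} = measure D A" if "i < n" "A \<in> sets borel" for i A
  proof -
    have "measure D A = measure (distr M borel (X i)) A"
      using dist[OF that(1)] by simp
    then show ?thesis
      using that by (simp add: measure_distr vimage_def Int_def conj_commute)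
  qed
  have "\<exists>x. cdf D x = u" if "0 < u" "u < 1" for u
    using D.ex_quantile that no_atom by (simp add: D.isCont_cdf)
  then obtain q where q: "\<And>u. 0 < u \<Longrightarrow> u < 1 \<Longrightarrow> cdf D (q u) = u"
    by metis
  have less: "x < y" if "cdf D x < cdf D y" for x y
    using that D.cdf_nondecreasing[of y x] by force
  have q_mono: "q u \<le> q v" if "u \<le> v" "0 < u" "v < 1" for u v
    using that less[of "q u" "q v"] q by (cases "u = v") force+
  \<comment> \<open>By symmetry around the median, the sets from the left and from the right share their probabilities.\<close>
  define p where "p k = min (k / n) (1 / 2)" for k :: nat
  define B where "B k = (if k = 0 then {} else {..q (p k)})" for k
  define C where "C k = (if k = 0 then {} else {q (1 - p k)<..})" for k
  have p_pos: "0 < p k" if "k \<noteq> 0" for k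
    using that n by (simp add: p_def)
  have p_half: "p k \<le> 1 / 2" for k
    unfolding p_def by (rule min.cobounded2)
  have p_mono: "p j \<le> p k" if "j \<le> k" for j k
  proof -
    have "real j / n \<le> real k / n"
      using that by (intro divide_right_mono) auto
    then show ?thesis unfolding p_def by (rule min.mono) simp
  qed
  have measure_B: "measure D (B k) = p k" for k
    using q[of "p k"] p_pos[of k] p_half[of k] by (auto simp: B_def cdf_def p_def[of 0])
  have measure_C: "measure D (C k) = p k" for k
  proof (cases "k = 0")
    case False
    have "C k = space D - {..q (1 - p k)}"
      using False by (auto simp: C_def)
    then have "measure D (C k) = 1 - cdf D (q (1 - p k))"
      using D.prob_compl[of "{..q (1 - p k)}"] by (simp add: cdf_def)
    then show ?thesis
      using q[of "1 - p k"] p_pos[OF False] p_half[of k] by simp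
  qed (simp add: C_def p_def)
  have B_mono: "B j \<subseteq> B k" and C_mono: "C j \<subseteq> C k" if "j \<le> k" for j k
  proof -
    have "q (p j) \<le> q (p k)" "q (1 - p k) \<le> q (1 - p j)" if "j \<noteq> 0"
      using p_mono[OF \<open>j \<le> k\<close>] p_pos[OF that] p_half[of j] p_half[of k] by (auto intro!: q_mono)
    then show "B j \<subseteq> B k" "C j \<subseteq> C k"
      using \<open>j \<le> k\<close> by (auto simp: B_def C_def)
  qed
  define r where "r = l * sqrt n"
  have r: "0 < r" using l n by (simp add: r_def)
  define EB where "EB = {\<omega> \<in> space M. \<exists>k\<le>n. r \<le> \<bar>\<Sum>i<n. indicator (B k) (X i \<omega>) - p k\<bar>}"
  define EC where "EC = {\<omega> \<in> space M. \<exists>k\<le>n. r \<le> \<bar>\<Sum>i<n. indicator (C k) (X i \<omega>) - p k\<bar>}"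
  have Bm[measurable]: "B k \<in> sets borel" "C k \<in> sets borel" for k
    by (auto simp: B_def C_def)
  have bound: "1 / 2 / (1 - 1 / 2) * n / r\<^sup>2 = 1 / l\<^sup>2"
    using n by (simp add: r_def power_mult_distrib)
  have EB: "prob EB \<le> 1 / l\<^sup>2"
    unfolding EB_def bound[symmetric]
    by (rule nested_deviation_maximal[OF indep]) (use B_mono prob_eq measure_B p_half r in auto)
  have EC: "prob EC \<le> 1 / l\<^sup>2"
    unfolding EC_def bound[symmetric]
    by (rule nested_deviation_maximal[OF indep]) (use C_mono prob_eq measure_C p_half r in auto)
  have meas: "EB \<in> events" "EC \<in> events"
    unfolding EB_def EC_def by measurable
  show ?thesis
  proof (intro bexI[of _ "EB \<union> EC"] conjI ballI allI impI)
    have "prob (EB \<union> EC) \<le> prob EB + prob EC"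
      using meas by (intro measure_Un_le) auto
    then show "prob (EB \<union> EC) \<le> 2 / l\<^sup>2"
      using EB EC by simp
    show "EB \<union> EC \<in> events" using meas by auto
  next
    fix \<omega> A and t :: real assume \<omega>: "\<omega> \<in> space M - (EB \<union> EC)" and A: "A = {..t} \<or> A = {..<t}"
    define c where "c S = (\<Sum>i<n. indicat_real S (X i \<omega>))" for S
    have c_mono: "c S \<le> c T" if "S \<subseteq> T" for S T
      unfolding c_def using that by (intro sum_mono) (auto simp: indicator_def)
    have c_le: "c S \<le> n" for S
    proof -
      have "c S \<le> (\<Sum>i<n. 1)" unfolding c_def by (intro sum_mono) (auto simp: indicator_def)
      then show ?thesis by simp
    qed
    have c_nonneg: "0 \<le> c S" for S
      unfolding c_def by (intro sum_nonneg) auto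
    have devB: "\<bar>c (B k) - n * p k\<bar> < r" and devC: "\<bar>c (C k) - n * p k\<bar> < r" if "k \<le> n" for k
      using \<omega> that by (auto simp: EB_def EC_def c_def sum_subtractf not_le) (meson linorder_not_le)+
    have dev: "\<bar>c {..q (real j / n)} - j\<bar> \<le> r" if "0 < j" "j < n" for j
    proof (cases "real j / n \<le> 1 / 2")
      case True
      then have "p j = real j / n" by (simp add: p_def)
      then show ?thesis
        using devB[of j] that by (simp add: B_def)
    next
      case False
      have eq: "real (n - j) / n = 1 - real j / n"
        using that n by (simp add: of_nat_diff field_simps)
      then have p: "p (n - j) = 1 - real j / n"
        using False by (simp add: p_def)
      have "c (C (n - j)) = n - c {..q (real j / n)}"
      proof -
        have "c (C (n - j)) = (\<Sum>i<n. 1 - indicat_real {..q (real j / n)} (X i \<omega>))"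
          unfolding c_def by (rule sum.cong) (use that p in \<open>auto simp: C_def indicator_def\<close>)
        then show ?thesis by (simp add: c_def sum_subtractf)
      qed
      moreover have "n * p (n - j) = n - real j"
        using n by (simp add: p field_simps)
      ultimately show ?thesis
        using devC[of "n - j"] by simp
    qed
    define u where "u = cdf D t"
    have mA: "measure D A = u"
    proof -
      have "{..t} = {..<t} \<union> {t}" by auto
      then have "measure D {..t} = measure D {..<t} + measure D {t}"
        by (simp only:) (intro D.finite_measure_Union, auto)
      then show ?thesis using A no_atom[of t] by (auto simp: u_def cdf_def)
    qed
    have u: "0 \<le> u" "u \<le> 1"
      by (auto simp: u_def cdf_def)
    have upper: "c A \<le> n * u + r + 1"
    proof -
      \<comment> \<open>\<open>j / n\<close> is the first grid level strictly above \<open>u\<close>.\<close>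
      define j where "j = nat \<lfloor>n * u\<rfloor> + 1"
      have j: "n * u < j" "j \<le> n * u + 1"
        using u by (auto simp: j_def) linarith+
      show ?thesis
      proof (cases "j < n")
        case True
        have "u < real j / n"
          using j n by (simp add: pos_less_divide_eq mult.commute)
        then have "t < q (real j / n)"
          using True j q[of "real j / n"] n by - (rule less, auto simp: u_def j_def)
        then have "c A \<le> c {..q (real j / n)}"
          using A by (intro c_mono) auto
        then show ?thesis
          using dev[of j] True j by (auto simp: j_def)
      next
        case False
        then have "real n \<le> n * u + 1" using j by linarith
        then show ?thesis using c_le[of A] r by linarith
      qed
    qed
    have lower: "n * u - r - 1 \<le> c A"
    proof (cases "n * u \<le> 1")
      case True
      then show ?thesis using c_nonneg[of A] r by linarith
    next
      case False
      \<comment> \<open>\<open>j / n\<close> is the last grid level strictly below \<open>u\<close>.\<close>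
      define j where "j = nat (\<lceil>n * u\<rceil> - 1)"
      have j: "j < n * u" "n * u \<le> j + 1" "0 < j"
        using False by (auto simp: j_def) linarith+
      have "real j < n"
        using j u by (smt (verit) mult_left_le of_nat_0_le_iff)
      have "real j / n < u"
        using j n by (simp add: pos_divide_less_eq mult.commute)
      then have "q (real j / n) < t"
        using \<open>real j < n\<close> j q[of "real j / n"] n by - (rule less, auto simp: u_def)
      then have "c {..q (real j / n)} \<le> c A"
        using A by (intro c_mono) auto
      then show ?thesis
        using dev[of j] \<open>real j < n\<close> j by auto
    qed
    have "\<bar>c A - n * u\<bar> \<le> r + 1"
      using upper lower by linarith
    then have "\<bar>c A - n * u\<bar> / n \<le> (r + 1) / n"
      by (rule divide_right_mono) simp
    moreover have "\<bar>c A - n * u\<bar> / n = \<bar>c A / n - u\<bar>"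
    proof -
      have "c A / n - u = (c A - n * u) / n"
        using n by (simp add: diff_divide_distrib)
      then show ?thesis by simp
    qed
    moreover have "(r + 1) / n = l / sqrt n + 1 / n"
      using n by (simp add: r_def field_simps)
    ultimately show "\<bar>(\<Sum>i<n. indicator A (X i \<omega>)) / n - measure D A\<bar> \<le> l / sqrt n + 1 / n"
      unfolding mA c_def by simp
  qed
qed

section \<open>Expectations through sublevel sets\<close>

text \<open>
  Integrate the layer-cake identity \<open>u = U - \<integral> 1\<^bsub>{u \<le> s}\<^esub> ds\<close> over \<open>-U \<le> s \<le> U\<close> and exchange the
  integrals.
\<close>

lemma (in prob_space) expectation_eq_integral_cdf:
  fixes u :: "'a \<Rightarrow> real"
  assumes u[measurable]: "u \<in> borel_measurable M" and U: "\<And>x. x \<in> space M \<Longrightarrow> \<bar>u x\<bar> \<le> U"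
  shows "expectation u = U - (LBINT s:{-U..U}. prob {x \<in> space M. u x \<le> s})"
    and "set_integrable lborel {-U..U} (\<lambda>s. prob {x \<in> space M. u x \<le> s})"
proof -
  interpret pair_sigma_finite M lborel ..
  let ?f = "\<lambda>x s. indicator {-U..U} s * of_bool (u x \<le> s) :: real"
  have U0: "0 \<le> U"
    using U not_empty by (metis abs_ge_zero equals0I order_trans)
  have inner: "(LBINT s. ?f x s) = U - u x" if "x \<in> space M" for x
  proof -
    have "(LBINT s. ?f x s) = (LBINT s. indicator {u x..U} s)"
      using U[OF that] by (intro Bochner_Integration.integral_cong) (auto simp: indicator_def)
    then show ?thesis using U[OF that] by simp
  qed
  have int: "integrable (M \<Otimes>\<^sub>M lborel) (\<lambda>(x, s). ?f x s)"
  proof (rule Bochner_Integration.integrable_bound)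
    have "emeasure (M \<Otimes>\<^sub>M lborel) (space M \<times> {-U..U}) < \<infinity>"
      by (subst lborel.emeasure_pair_measure_Times) (auto simp: emeasure_space_1 emeasure_lborel_Icc_eq)
    then show "integrable (M \<Otimes>\<^sub>M lborel) (indicat_real (space M \<times> {-U..U}))"
      by (intro integrable_real_indicator) auto
    show "(\<lambda>(x, s). ?f x s) \<in> borel_measurable (M \<Otimes>\<^sub>M lborel)"
      by measurable
  qed (auto simp: space_pair_measure indicator_def intro!: AE_I2)
  have outer: "(\<integral>x. ?f x s \<partial>M) = indicator {-U..U} s * prob {x \<in> space M. u x \<le> s}" for s
  proof -
    have "(\<integral>x. ?f x s \<partial>M) = indicator {-U..U} s * (\<integral>x. indicator {x \<in> space M. u x \<le> s} x \<partial>M)"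
      unfolding integral_mult_right_zero[symmetric]
      by (intro Bochner_Integration.integral_cong) (auto simp: indicator_def)
    then show ?thesis by (simp add: Int_absorb2)
  qed
  have "(\<integral>x. U - u x \<partial>M) = (\<integral>x. (LBINT s. ?f x s) \<partial>M)"
    using inner by (intro Bochner_Integration.integral_cong) auto
  also have "\<dots> = (LBINT s. (\<integral>x. ?f x s \<partial>M))"
    using Fubini_integral[OF int] by simp
  also have "\<dots> = (LBINT s:{-U..U}. prob {x \<in> space M. u x \<le> s})"
    unfolding set_lebesgue_integral_def outer by simp
  finally have "(\<integral>x. U - u x \<partial>M) = (LBINT s:{-U..U}. prob {x \<in> space M. u x \<le> s})" .
  moreover have "integrable M u"
    using U by (intro integrable_const_bound[where B=U]) auto
  ultimately show "expectation u = U - (LBINT s:{-U..U}. prob {x \<in> space M. u x \<le> s})"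
    by (simp add: prob_space)
  show "set_integrable lborel {-U..U} (\<lambda>s. prob {x \<in> space M. u x \<le> s})"
    using integrable_snd[OF int] unfolding set_integrable_def outer by simp
qed

text \<open>
  Only the sublevel sets of the integrands enter, which is what allows integrals of functions with
  interval sublevel sets to be compared through distribution functions, without any regularity.
\<close>

lemma expectation_diff_le_cdf_diff:
  fixes u :: "'a \<Rightarrow> real" and v :: "'b \<Rightarrow> real"
  assumes P: "prob_space P" "u \<in> borel_measurable P" "\<And>x. x \<in> space P \<Longrightarrow> \<bar>u x\<bar> \<le> U"
    and Q: "prob_space Q" "v \<in> borel_measurable Q" "\<And>x. x \<in> space Q \<Longrightarrow> \<bar>v x\<bar> \<le> U"
    and d: "\<And>s. \<bar>measure P {x \<in> space P. u x \<le> s} - measure Q {x \<in> space Q. v x \<le> s}\<bar> \<le> d"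
  shows "\<bar>(\<integral>x. u x \<partial>P) - (\<integral>x. v x \<partial>Q)\<bar> \<le> 2 * U * d"
proof -
  interpret P: prob_space P by fact
  interpret Q: prob_space Q by fact
  let ?p = "\<lambda>s. measure P {x \<in> space P. u x \<le> s}" and ?q = "\<lambda>s. measure Q {x \<in> space Q. v x \<le> s}"
  note p = P.expectation_eq_integral_cdf[OF P(2,3)] and q = Q.expectation_eq_integral_cdf[OF Q(2,3)]
  have U0: "0 \<le> U"
    using P(3) P.not_empty by (metis abs_ge_zero equals0I order_trans)
  have "(\<integral>x. u x \<partial>P) - (\<integral>x. v x \<partial>Q) = (LBINT s:{-U..U}. ?q s - ?p s)"
    using p q by (simp add: set_integral_diff)
  also have "\<bar>\<dots>\<bar> \<le> (LBINT s:{-U..U}. \<bar>?q s - ?p s\<bar>)"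
    using set_integral_norm_bound[OF set_integral_diff(1)[OF q(2) p(2)]] by simp
  also have "\<dots> \<le> (LBINT s:{-U..U}. d)"
  proof (intro set_integral_mono set_integrable_abs set_integral_diff p(2) q(2))
    show "set_integrable lborel {-U..U} (\<lambda>s. d)"
      unfolding set_integrable_def
      by (intro integrable_scaleR_left) (simp add: integrable_indicator_iff emeasure_lborel_Icc_eq)
    show "\<bar>?q s - ?p s\<bar> \<le> d" for s
      using d[of s] by (simp add: abs_minus_commute)
  qed
  also have "\<dots> = 2 * U * d"
    using U0 by (simp add: set_lebesgue_integral_def)
  finally show ?thesis .
qed

section \<open>Convex functions on an interval\<close>

lemma convex_on_three_points:
  fixes h :: "real \<Rightarrow> real"
  assumes "convex_on S h" "x \<in> S" "z \<in> S" "x \<le> y" "y \<le> z"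
  shows "(z - x) * h y \<le> (z - y) * h x + (y - x) * h z"
proof (cases "x = z")
  case False
  then have xz: "x < z" using assms by simp
  define t where "t = (y - x) / (z - x)"
  have t: "0 \<le> t" "t \<le> 1" "1 - t = (z - y) / (z - x)"
    using assms xz by (auto simp: t_def field_simps)
  have "(1 - t) * x + t * z = x + t * (z - x)" by (simp add: algebra_simps)
  then have "(1 - t) *\<^sub>R x + t *\<^sub>R z = y"
    using xz by (simp add: t_def)
  then have "h y \<le> (1 - t) * h x + t * h z"
    using convex_onD[OF assms(1) t(1,2) assms(2,3)] by simp
  then have "(z - x) * h y \<le> (z - x) * ((1 - t) * h x + t * h z)"
    using xz by (intro mult_left_mono) auto
  moreover have "(z - x) * (1 - t) = z - y" "(z - x) * t = y - x"
    unfolding t(3) using xz by (simp_all add: t_def)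
  ultimately show ?thesis
    by (simp only: distrib_left mult.assoc[symmetric])
qed (use assms in auto)

lemma convex_on_reflect:
  fixes h :: "real \<Rightarrow> real"
  assumes "convex_on {a..b} h"
  shows "convex_on {-b..-a} (\<lambda>t. h (- t))"
proof (rule convex_onI)
  fix t x y :: real assume "0 < t" "t < 1" "x \<in> {-b..-a}" "y \<in> {-b..-a}"
  then have "h ((1 - t) *\<^sub>R (- x) + t *\<^sub>R (- y)) \<le> (1 - t) * h (- x) + t * h (- y)"
    by (intro convex_onD[OF assms]) auto
  then show "h (- ((1 - t) *\<^sub>R x + t *\<^sub>R y)) \<le> (1 - t) * h (- x) + t * h (- y)"
    by simp
qed simp

lemma continuous_on_reflect:
  fixes h :: "real \<Rightarrow> real"
  assumes "continuous_on {a..b} h"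
  shows "continuous_on {-b..-a} (\<lambda>t. h (- t))"
  by (rule continuous_on_compose2[OF assms]) (auto intro!: continuous_on_minus continuous_on_id)

text \<open>
  Choice of the point \<open>c\<close> from which on a convex function will be replaced by its value at \<open>c\<close>.
  If the minimum over \<open>{m..b}\<close> is nonnegative, \<open>c\<close> is the minimiser; otherwise \<open>c\<close> is the zero
  where \<open>h\<close> leaves the negative values, or \<open>b\<close> if it never does. The three properties serve
  different ends: what is cut off lies above the constant; the constant is nonnegative unless
  nothing is cut off; and if it is positive, then it is either the value at the fixed point \<open>m\<close> or a
  lower bound of \<open>h\<close> to the left of \<open>m\<close>.
\<close>

lemma ex_right_cut_point:
  fixes h :: "real \<Rightarrow> real"
  assumes conv: "convex_on {a..b} h" and cont: "continuous_on {a..b} h" and m: "a \<le> m" "m \<le> b"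
  shows "\<exists>c\<in>{m..b}. (\<forall>t\<in>{c..b}. h c \<le> h t) \<and> (0 \<le> h c \<or> c = b) \<and>
           (c = m \<or> h c \<le> 0 \<or> (\<forall>t\<in>{a..m}. h c \<le> h t))"
proof -
  have cont': "continuous_on {m..b} h"
    using cont m by (auto intro: continuous_on_subset)
  obtain c0 where c0: "c0 \<in> {m..b}" "\<And>t. t \<in> {m..b} \<Longrightarrow> h c0 \<le> h t"
    using continuous_attains_inf[of "{m..b}" h] cont' m by auto
  consider "0 \<le> h c0" | "h c0 < 0" "0 \<le> h b" | "h b < 0"
    by linarith
  then show ?thesis
  proof cases
    case 1
    have "h c0 \<le> h t" if "c0 \<noteq> m" "t \<in> {a..m}" for t
    proof (rule ccontr)
      assume "\<not> h c0 \<le> h t"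
      then have less: "h t < h c0" by simp
      have le: "h c0 \<le> h m" using c0(2)[of m] m by simp
      have tm: "t < m" using less le that by (cases "t = m") auto
      have mc: "m < c0" using that c0 by simp
      have "(c0 - t) * h m \<le> (c0 - m) * h t + (m - t) * h c0"
        using tm mc c0 m that by (intro convex_on_three_points[OF conv]) auto
      also have "\<dots> < (c0 - m) * h c0 + (m - t) * h c0"
        using less mc by simp
      also have "\<dots> = (c0 - t) * h c0" by (simp add: algebra_simps)
      finally show False using le tm mc by simp
    qed
    then show ?thesis using 1 c0 by (intro bexI[of _ c0]) auto
  next
    case 2
    have "continuous_on {c0..b} h"
      using c0 cont' by (auto intro: continuous_on_subset)
    then have "\<exists>c\<ge>c0. c \<le> b \<and> h c = 0"
      using IVT'[of h c0 0 b] 2 c0 by simp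
    then obtain c where c: "c0 \<le> c" "c \<le> b" "h c = 0"
      by blast
    have "c0 < c" using c 2 by (cases "c0 = c") auto
    have "0 \<le> h t" if "t \<in> {c..b}" for t
    proof -
      have "(t - c0) * h c \<le> (t - c) * h c0 + (c - c0) * h t"
        using that c c0 m by (intro convex_on_three_points[OF conv]) auto
      moreover have "(t - c) * h c0 \<le> 0"
        using that 2 by (simp add: mult_nonneg_nonpos)
      ultimately have "0 \<le> (c - c0) * h t" using c by simp
      then show ?thesis using \<open>c0 < c\<close> by (simp add: zero_le_mult_iff)
    qed
    then show ?thesis using c c0 by (intro bexI[of _ c]) auto
  next
    case 3
    then show ?thesis using m by (intro bexI[of _ b]) auto
  qed
qed

lemma ex_left_cut_point:
  fixes h :: "real \<Rightarrow> real"
  assumes conv: "convex_on {a..b} h" and cont: "continuous_on {a..b} h" and m: "a \<le> m" "m \<le> b"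
  shows "\<exists>c\<in>{a..m}. (\<forall>t\<in>{a..c}. h c \<le> h t) \<and> (0 \<le> h c \<or> c = a) \<and>
           (c = m \<or> h c \<le> 0 \<or> (\<forall>t\<in>{m..b}. h c \<le> h t))"
proof -
  have "- b \<le> - m" "- m \<le> - a"
    using m by auto
  from ex_right_cut_point[OF convex_on_reflect[OF conv] continuous_on_reflect[OF cont] this]
  obtain c where c: "c \<in> {-m..-a}" "\<forall>t\<in>{c..-a}. h (- c) \<le> h (- t)" "0 \<le> h (- c) \<or> c = -a"
     "c = -m \<or> h (- c) \<le> 0 \<or> (\<forall>t\<in>{-b..-m}. h (- c) \<le> h (- t))"
    by blast
  show ?thesis
  proof (intro bexI[of _ "- c"] conjI ballI)
    show "h (- c) \<le> h t" if "t \<in> {a..- c}" for t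
      using that c(2) by (auto dest: bspec[of _ _ "- t"])
    show "- c = m \<or> h (- c) \<le> 0 \<or> (\<forall>t\<in>{m..b}. h (- c) \<le> h t)"
    proof -
      have "h (- c) \<le> h t" if "\<forall>t\<in>{-b..-m}. h (- c) \<le> h (- t)" "t \<in> {m..b}" for t
        using bspec[OF that(1), of "- t"] that(2) by simp
      then show ?thesis using c(4) by (auto simp: equation_minus_iff)
    qed
  qed (use c in auto)
qed

text \<open>
  Completing the square in the slope: the integral equals
  \<open>\<alpha>\<^sup>2 * d / 4 + d * (3 * \<alpha> / 2 + k * d)\<^sup>2 / 3\<close> with \<open>d = r - s\<close>.
\<close>

lemma affine_L2_lower_bound:
  fixes \<alpha> k :: real
  assumes "s \<le> r"
  shows "\<alpha>\<^sup>2 * (r - s) / 4 \<le> (LBINT t:{s..r}. (\<alpha> + k * (t - s))\<^sup>2)"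
proof -
  let ?F = "\<lambda>t. \<alpha>\<^sup>2 * (t - s) + \<alpha> * k * (t - s)\<^sup>2 + k\<^sup>2 * (t - s) ^ 3 / 3"
  define d where "d = r - s"
  have "(\<integral>t. (\<alpha> + k * (t - s))\<^sup>2 * indicator {s..r} t \<partial>lborel) = ?F r - ?F s"
  proof (rule integral_FTC_Icc_real[OF assms])
    show "DERIV ?F x :> (\<alpha> + k * (x - s))\<^sup>2" for x
      by (rule derivative_eq_intros refl | simp)+ (simp add: power2_eq_square algebra_simps)
  qed (intro continuous_intros)
  then have "(LBINT t:{s..r}. (\<alpha> + k * (t - s))\<^sup>2) = ?F r - ?F s"
    by (simp add: set_lebesgue_integral_def mult.commute)
  also have "\<dots> = \<alpha>\<^sup>2 * d + \<alpha> * k * d\<^sup>2 + k\<^sup>2 * d ^ 3 / 3"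
    by (simp add: d_def)
  also have "\<dots> = \<alpha>\<^sup>2 * d / 4 + d * (3 * \<alpha> / 2 + k * d)\<^sup>2 / 3"
    by (simp add: power2_eq_square power3_eq_cube field_simps)
  finally show ?thesis using assms by (simp add: d_def)
qed

text \<open>
  Compare \<open>h\<close> with the line through \<open>(s, h s)\<close> and \<open>(z, 0)\<close>, where \<open>z\<close> is a zero of \<open>h\<close>, or
  \<open>z = r\<close> if \<open>h\<close> stays negative. By convexity \<open>h\<close> lies below this line before \<open>z\<close>, where the line
  is negative, and above it after \<open>z\<close>, where the line is positive; so \<open>\<bar>h\<bar>\<close> dominates the modulus
  of an affine function throughout. Nothing is assumed about the size of \<open>h\<close> near \<open>r\<close>.
\<close>

lemma convex_L2_lower_bound:
  fixes h :: "real \<Rightarrow> real"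
  assumes conv: "convex_on {s..r} h" and cont: "continuous_on {s..r} h"
    and sr: "s \<le> r" and neg: "h s \<le> 0"
  shows "(h s)\<^sup>2 * (r - s) / 4 \<le> (LBINT t:{s..r}. (h t)\<^sup>2)"
proof (cases "h s = 0 \<or> s = r")
  case True
  then show ?thesis
    by (auto simp: set_lebesgue_integral_def intro!: integral_nonneg)
next
  case False
  then have hs: "h s < 0" and sr': "s < r" using neg sr by auto
  have "\<exists>z\<in>{s<..r}. h z \<le> 0 \<and> (h z = 0 \<or> z = r)"
  proof (cases "h r \<le> 0")
    case True
    then show ?thesis using sr' by auto
  next
    case f: False
    then obtain z where z: "s \<le> z" "z \<le> r" "h z = 0"
      using IVT'[of h s 0 r] hs sr cont by auto
    then have "s < z" using hs by (cases "s = z") auto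
    then show ?thesis using z by (intro bexI[of _ z]) auto
  qed
  then obtain z where z: "s < z" "z \<le> r" "h z \<le> 0" "h z = 0 \<or> z = r" by auto
  define k where "k = - h s / (z - s)"
  have A_eq: "h s + k * (t - s) = h s * (z - t) / (z - s)" for t
    using z by (simp add: k_def field_simps)
  have le: "(h s + k * (t - s))\<^sup>2 \<le> (h t)\<^sup>2" if t: "t \<in> {s..r}" for t
  proof (cases "t \<le> z")
    case True
    have "(z - s) * h t \<le> (z - t) * h s + (t - s) * h z"
      using True t z by (intro convex_on_three_points[OF conv]) auto
    also have "\<dots> \<le> (z - t) * h s"
      using t z by (simp add: mult_nonneg_nonpos)
    finally have "h t \<le> h s + k * (t - s)"
      unfolding A_eq using z by (simp add: pos_le_divide_eq mult.commute)
    moreover have "h s + k * (t - s) \<le> 0"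
      unfolding A_eq using True z hs by (intro divide_nonpos_pos mult_nonpos_nonneg) auto
    ultimately show ?thesis
      by (intro abs_le_square_iff[THEN iffD1]) auto
  next
    case f: False
    then have hz: "h z = 0" using z t by auto
    have "(t - s) * h z \<le> (t - z) * h s + (z - s) * h t"
      using f t z by (intro convex_on_three_points[OF conv]) auto
    then have "h s * (z - t) \<le> h t * (z - s)"
      using hz by (simp add: algebra_simps)
    then have "h s + k * (t - s) \<le> h t"
      unfolding A_eq using z by (simp add: pos_divide_le_eq)
    moreover have "0 \<le> h s + k * (t - s)"
      unfolding A_eq using f z hs by (intro divide_nonneg_pos mult_nonpos_nonpos) auto
    ultimately show ?thesis
      by (intro power_mono) auto
  qed
  have "(h s)\<^sup>2 * (r - s) / 4 \<le> (LBINT t:{s..r}. (h s + k * (t - s))\<^sup>2)"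
    by (rule affine_L2_lower_bound[OF sr])
  also have "\<dots> \<le> (LBINT t:{s..r}. (h t)\<^sup>2)"
    using cont by (intro set_integral_mono borel_integrable_atLeastAtMost' continuous_intros le) auto
  finally show ?thesis .
qed

lemma convex_L2_lower_bound_left:
  fixes h :: "real \<Rightarrow> real"
  assumes conv: "convex_on {s..r} h" and cont: "continuous_on {s..r} h"
    and sr: "s \<le> r" and neg: "h r \<le> 0"
  shows "(h r)\<^sup>2 * (r - s) / 4 \<le> (LBINT t:{s..r}. (h t)\<^sup>2)"
proof -
  have refl: "{x. - x \<in> {-r..-s}} = {s..r}"
    by auto
  from convex_L2_lower_bound[OF convex_on_reflect[OF conv] continuous_on_reflect[OF cont]]
  have "(h r)\<^sup>2 * (r - s) / 4 \<le> (LBINT t:{-r..-s}. (h (- t))\<^sup>2)"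
    using sr neg by simp
  also have "\<dots> = (LBINT t:{x. - x \<in> {-r..-s}}. (h (- (- t)))\<^sup>2)"
    by (rule set_integral_reflect)
  finally show ?thesis
    unfolding refl minus_minus .
qed

lemma set_integral_subset_mono:
  fixes f :: "real \<Rightarrow> real"
  assumes "set_integrable lborel B f" "A \<in> sets borel" "A \<subseteq> B" "\<And>t. t \<in> B \<Longrightarrow> 0 \<le> f t"
  shows "(LBINT t:A. f t) \<le> (LBINT t:B. f t)"
proof -
  have "set_integrable lborel A f"
    using assms by (auto intro: set_integrable_subset)
  then show ?thesis
    using assms unfolding set_lebesgue_integral_def set_integrable_def
    by (intro integral_mono) (auto simp: indicator_def)
qed

lemma L2_ge_of_const_bound:
  fixes f :: "real \<Rightarrow> real"
  assumes "continuous_on {0..1} f" "0 \<le> s" "s \<le> r" "r \<le> 1" "0 \<le> K" "\<And>t. t \<in> {s..r} \<Longrightarrow> K \<le> f t"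
  shows "K\<^sup>2 * (r - s) \<le> (LBINT t:{0..1}. (f t)\<^sup>2)"
proof -
  have "K\<^sup>2 * (r - s) = (LBINT t:{s..r}. K\<^sup>2)"
    using assms by (simp add: set_lebesgue_integral_def)
  also have "\<dots> \<le> (LBINT t:{s..r}. (f t)\<^sup>2)"
    using assms by (intro set_integral_mono borel_integrable_atLeastAtMost' continuous_intros power_mono)
      (auto intro: continuous_on_subset)
  also have "\<dots> \<le> (LBINT t:{0..1}. (f t)\<^sup>2)"
    using assms by (intro set_integral_subset_mono borel_integrable_atLeastAtMost' continuous_intros) auto
  finally show ?thesis .
qed

lemma convex_on_le_max_endpoints:
  fixes h :: "real \<Rightarrow> real"
  assumes "convex_on S h" "x \<in> S" "z \<in> S" "x \<le> y" "y \<le> z"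
  shows "h y \<le> max (h x) (h z)"
proof (cases "x = z")
  case False
  then have xz: "x < z" using assms by simp
  have "(z - x) * h y \<le> (z - y) * h x + (y - x) * h z"
    by (rule convex_on_three_points[OF assms])
  also have "\<dots> \<le> (z - y) * max (h x) (h z) + (y - x) * max (h x) (h z)"
    using assms by (intro add_mono mult_left_mono) auto
  also have "\<dots> = (z - x) * max (h x) (h z)"
    by (simp only: distrib_right[symmetric]) simp
  finally show ?thesis using xz by simp
qed (use assms in auto)

text \<open>
  For a convex function frozen outside \<open>{a..c}\<close> as chosen by the cut points, the \<open>L\<^sup>2\<close> norm
  controls the supremum with a constant that depends on \<open>b\<close> and \<open>m\<close> only, although \<open>a\<close> and \<open>c\<close> may be
  arbitrarily close to 0 and 1 and \<open>h\<close> arbitrarily steep there. A negative value at \<open>\<tau>\<close> spreads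
  over \<open>{\<tau>..m}\<close> or \<open>{b..\<tau>}\<close>, one of which has at least half the length of \<open>{b..m}\<close>. A positive value
  is at most the one at \<open>a\<close> or at \<open>c\<close>, which \<open>u\<close> takes on all of \<open>{0..b}\<close> or \<open>{m..1}\<close> if the cut
  point is \<open>b\<close> or \<open>m\<close>, and which otherwise is a lower bound of \<open>h\<close> on \<open>{b..m}\<close>.
\<close>

lemma clamped_convex_sup_le_L2:
  fixes h :: "real \<Rightarrow> real"
  assumes conv: "convex_on {0..1} h" and cont: "continuous_on {0..1} h"
    and ord: "0 \<le> a" "a \<le> b" "b < m" "m \<le> c" "c \<le> 1"
    and left: "a = b \<or> h a \<le> 0 \<or> (\<forall>t\<in>{b..m}. h a \<le> h t)"
    and right: "c = m \<or> h c \<le> 0 \<or> (\<forall>t\<in>{b..m}. h c \<le> h t)"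
    and \<delta>: "0 \<le> \<delta>" "\<delta> \<le> b" "\<delta> \<le> 1 - m" "\<delta> \<le> (m - b) / 8"
    and u: "u = (\<lambda>t. h (max a (min t c)))"
  shows "\<delta> * (u t)\<^sup>2 \<le> (LBINT t:{0..1}. (u t)\<^sup>2)"
proof -
  let ?I = "LBINT t:{0..1}. (u t)\<^sup>2"
  have u_cont: "continuous_on {0..1} u"
    unfolding u using ord by (intro continuous_on_compose2[OF cont] continuous_intros) auto
  have u_mid: "u t = h t" if "t \<in> {a..c}" for t
    using that ord by (auto simp: u)
  define \<tau> where "\<tau> = max a (min t c)"
  have \<tau>: "a \<le> \<tau>" "\<tau> \<le> c" "u t = h \<tau>"
    using ord by (auto simp: \<tau>_def u)
  have sub: "(LBINT t:{s..r}. (h t)\<^sup>2) \<le> ?I" if "a \<le> s" "s \<le> r" "r \<le> c" for s r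
  proof -
    have "(LBINT t:{s..r}. (h t)\<^sup>2) = (LBINT t:{s..r}. (u t)\<^sup>2)"
      using that by (intro set_lebesgue_integral_cong) (auto simp: u_mid)
    also have "\<dots> \<le> ?I"
      using that ord u_cont
      by (intro set_integral_subset_mono borel_integrable_atLeastAtMost' continuous_intros) auto
    finally show ?thesis .
  qed
  show ?thesis
  proof (cases "h \<tau> \<le> 0")
    case True
    have half: "\<delta> * (h \<tau>)\<^sup>2 \<le> (h \<tau>)\<^sup>2 * l / 4" if "(m - b) / 2 \<le> l" for l
    proof -
      have "\<delta> * (h \<tau>)\<^sup>2 \<le> l / 4 * (h \<tau>)\<^sup>2"
        using that \<delta> by (intro mult_right_mono) auto
      then show ?thesis by (simp add: mult.commute)
    qed
    show ?thesis
    proof (cases "\<tau> \<le> (b + m) / 2")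
      case short: True
      then have "(m - b) / 2 \<le> m - \<tau>" by (simp add: field_simps)
      then have "\<delta> * (h \<tau>)\<^sup>2 \<le> (h \<tau>)\<^sup>2 * (m - \<tau>) / 4" by (rule half)
      also have "\<dots> \<le> (LBINT t:{\<tau>..m}. (h t)\<^sup>2)"
        using short True \<tau> ord
        by (intro convex_L2_lower_bound convex_on_subset[OF conv] continuous_on_subset[OF cont]) auto
      also have "\<dots> \<le> ?I"
        using short \<tau> ord by (intro sub) auto
      finally show ?thesis by (simp add: \<tau>)
    next
      case long: False
      then have "(m - b) / 2 \<le> \<tau> - b" by (simp add: field_simps)
      then have "\<delta> * (h \<tau>)\<^sup>2 \<le> (h \<tau>)\<^sup>2 * (\<tau> - b) / 4" by (rule half)
      also have "\<dots> \<le> (LBINT t:{b..\<tau>}. (h t)\<^sup>2)"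
        using long True \<tau> ord
        by (intro convex_L2_lower_bound_left convex_on_subset[OF conv] continuous_on_subset[OF cont]) auto
      also have "\<dots> \<le> ?I"
        using long \<tau> ord by (intro sub) auto
      finally show ?thesis by (simp add: \<tau>)
    qed
  next
    case False
    have bound: "\<delta> * K\<^sup>2 \<le> ?I"
      if "0 \<le> s" "s \<le> r" "r \<le> 1" "\<delta> \<le> r - s" "0 \<le> K" "\<And>t. t \<in> {s..r} \<Longrightarrow> K \<le> u t" for s r K
    proof -
      have "\<delta> * K\<^sup>2 \<le> (r - s) * K\<^sup>2"
        using that by (intro mult_right_mono) auto
      also have "\<dots> \<le> ?I"
        using L2_ge_of_const_bound[OF u_cont that(1-3,5,6)] by (simp add: mult.commute)
      finally show ?thesis .
    qed
    have mid: "\<delta> \<le> m - b"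
      using \<delta> ord by (simp add: field_simps)
    have le_end: "\<delta> * (h \<tau>)\<^sup>2 \<le> \<delta> * (h e)\<^sup>2" if "h \<tau> \<le> h e" for e
      using that False \<delta> by (intro mult_left_mono power_mono) auto
    have "h \<tau> \<le> max (h a) (h c)"
      using \<tau> ord by (intro convex_on_le_max_endpoints[OF conv]) auto
    then consider "h \<tau> \<le> h a" | "h \<tau> \<le> h c" by linarith
    then show ?thesis
    proof cases
      case 1
      have "\<delta> * (h a)\<^sup>2 \<le> ?I"
      proof (cases "a = b")
        case True
        show ?thesis
          by (rule bound[of 0 b]) (use True 1 False ord \<delta> in \<open>auto simp: u\<close>)
      next
        case f: False
        then have "\<forall>t\<in>{b..m}. h a \<le> h t" using left 1 False by auto
        then show ?thesis
          by (intro bound[of b m]) (use 1 False ord mid in \<open>auto simp: u_mid\<close>)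
      qed
      then show ?thesis using le_end[OF 1] by (simp add: \<tau>)
    next
      case 2
      have "\<delta> * (h c)\<^sup>2 \<le> ?I"
      proof (cases "c = m")
        case True
        show ?thesis
          by (rule bound[of m 1]) (use True 2 False ord \<delta> in \<open>auto simp: u\<close>)
      next
        case f: False
        then have "\<forall>t\<in>{b..m}. h c \<le> h t" using right 2 False by auto
        then show ?thesis
          by (intro bound[of b m]) (use 2 False ord mid in \<open>auto simp: u_mid\<close>)
      qed
      then show ?thesis using le_end[OF 2] by (simp add: \<tau>)
    qed
  qed
qed

text \<open>
  Convexity is lost by freezing, but the sublevel sets remain intervals because clamping is monotone.
\<close>

lemma clamped_convex_sublevel:
  fixes h :: "real \<Rightarrow> real"
  assumes conv: "convex_on {0..1} h" and cont: "continuous_on {0..1} h"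
    and ord: "0 \<le> a" "a \<le> c" "c \<le> 1"
  shows "\<exists>\<alpha> \<beta>. {t\<in>{0..1}. h (max a (min t c)) \<le> s} = {\<alpha>..\<beta>}"
proof -
  let ?S = "{t\<in>{0..1}. h (max a (min t c)) \<le> s}"
  have "continuous_on {0..1} (\<lambda>t. h (max a (min t c)))"
    using ord by (intro continuous_on_compose2[OF cont] continuous_intros) auto
  then have "closed ?S"
    by (intro continuous_on_closed_Collect_le continuous_on_const) auto
  then have "compact ?S"
    unfolding compact_eq_bounded_closed
    by (intro conjI bounded_subset[OF bounded_closed_interval[of 0 1]]) auto
  moreover have "connected ?S"
    unfolding is_interval_connected_1[symmetric] is_interval_1
  proof (intro ballI allI impI)
    fix x z y assume xz: "x \<in> ?S" "z \<in> ?S" and y: "x \<le> y \<and> y \<le> z"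
    have "h (max a (min y c)) \<le> max (h (max a (min x c))) (h (max a (min z c)))"
      using y ord by (intro convex_on_le_max_endpoints[OF conv]) (auto simp: max_def min_def)
    also have "\<dots> \<le> s" using xz by simp
    finally show "y \<in> ?S" using xz y by auto
  qed
  ultimately show ?thesis
    using connected_compact_interval_1[of ?S] by blast
qed

lemma convex_on_max_fun:
  fixes f g :: "'a::real_vector \<Rightarrow> real"
  assumes "convex_on S f" "convex_on S g"
  shows "convex_on S (\<lambda>x. max (f x) (g x))"
proof (rule convex_onI)
  fix t x y assume t: "0 < t" "t < (1::real)" and xy: "x \<in> S" "y \<in> S"
  have *: "(1 - t) * p x + t * p y \<le> (1 - t) * max (f x) (g x) + t * max (f y) (g y)"
    if "p = f \<or> p = g" for p
    using that t by (intro add_mono mult_left_mono) auto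
  show "max (f ((1 - t) *\<^sub>R x + t *\<^sub>R y)) (g ((1 - t) *\<^sub>R x + t *\<^sub>R y))
      \<le> (1 - t) * max (f x) (g x) + t * max (f y) (g y)"
    using convex_onD[OF assms(1), of t x y] convex_onD[OF assms(2), of t x y] *[of f] *[of g] t xy
    by simp
qed (use assms convex_on_imp_convex in auto)

text \<open>
  Replacing a convex function by its minimum on one side of the minimiser keeps it convex. The
  companion below does the same on the other side.
\<close>

lemma convex_on_flatten_left:
  fixes \<phi> :: "real \<Rightarrow> real"
  assumes conv: "convex_on {a..} \<phi>" and c: "a \<le> c" and min: "\<And>t. c \<le> t \<Longrightarrow> \<phi> c \<le> \<phi> t"
  shows "convex_on {a..} (\<lambda>t. \<phi> (max t c))"
proof (rule convex_onI)
  have mono: "\<phi> x \<le> \<phi> y" if "c \<le> x" "x \<le> y" for x y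
    using convex_on_le_max_endpoints[OF conv, of c y x] min[of y] that c by simp
  fix t x y assume t: "0 < t" "t < (1::real)" and xy: "x \<in> {a..}" "y \<in> {a..}"
  have "max ((1 - t) *\<^sub>R x + t *\<^sub>R y) c \<le> (1 - t) *\<^sub>R max x c + t *\<^sub>R max y c"
  proof -
    have "(1 - t) * x + t * y \<le> (1 - t) * max x c + t * max y c"
      using t by (intro add_mono mult_left_mono) auto
    moreover have "(1 - t) * c + t * c \<le> (1 - t) * max x c + t * max y c"
      using t by (intro add_mono mult_left_mono) auto
    moreover have "(1 - t) * c + t * c = c" by (simp add: algebra_simps)
    ultimately show ?thesis by simp
  qed
  then have "\<phi> (max ((1 - t) *\<^sub>R x + t *\<^sub>R y) c) \<le> \<phi> ((1 - t) *\<^sub>R max x c + t *\<^sub>R max y c)"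
    by (intro mono) auto
  also have "\<dots> \<le> (1 - t) * \<phi> (max x c) + t * \<phi> (max y c)"
    using t xy by (intro convex_onD[OF conv]) auto
  finally show "\<phi> (max ((1 - t) *\<^sub>R x + t *\<^sub>R y) c) \<le> (1 - t) * \<phi> (max x c) + t * \<phi> (max y c)" .
qed simp

lemma convex_on_flatten_right:
  fixes \<phi> :: "real \<Rightarrow> real"
  assumes conv: "convex_on {a..} \<phi>" and c: "a \<le> c" and min: "\<And>t. a \<le> t \<Longrightarrow> t \<le> c \<Longrightarrow> \<phi> c \<le> \<phi> t"
  shows "convex_on {a..} (\<lambda>t. \<phi> (min t c))"
proof (rule convex_onI)
  have mono: "\<phi> y \<le> \<phi> x" if "a \<le> x" "x \<le> y" "y \<le> c" for x y
    using convex_on_le_max_endpoints[OF conv, of x c y] min[of x] that c by simp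
  fix t x y assume t: "0 < t" "t < (1::real)" and xy: "x \<in> {a..}" "y \<in> {a..}"
  let ?z = "(1 - t) *\<^sub>R min x c + t *\<^sub>R min y c"
  have eq: "(1 - t) * s + t * s = s" for s by (simp add: algebra_simps)
  have "?z \<le> min ((1 - t) *\<^sub>R x + t *\<^sub>R y) c"
  proof -
    have "(1 - t) * min x c + t * min y c \<le> (1 - t) * x + t * y"
      using t by (intro add_mono mult_left_mono) auto
    moreover have "(1 - t) * min x c + t * min y c \<le> (1 - t) * c + t * c"
      using t by (intro add_mono mult_left_mono) auto
    ultimately show ?thesis by (simp add: eq)
  qed
  moreover have "a \<le> ?z"
  proof -
    have "(1 - t) * a + t * a \<le> (1 - t) * min x c + t * min y c"
      using t xy c by (intro add_mono mult_left_mono) auto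
    then show ?thesis by (simp add: eq)
  qed
  ultimately have "\<phi> (min ((1 - t) *\<^sub>R x + t *\<^sub>R y) c) \<le> \<phi> ?z"
    by (intro mono) auto
  also have "\<dots> \<le> (1 - t) * \<phi> (min x c) + t * \<phi> (min y c)"
    using t xy c by (intro convex_onD[OF conv]) auto
  finally show "\<phi> (min ((1 - t) *\<^sub>R x + t *\<^sub>R y) c) \<le> (1 - t) * \<phi> (min x c) + t * \<phi> (min y c)" .
qed simp

section \<open>The least squares estimator\<close>

text \<open>
  If \<open>g\<close> increased anywhere, convexity would keep it above a positive constant from there on,
  against integrability. In particular members of the cone are bounded by their value at 0,
  which makes their products integrable.
\<close>

lemma convex_cone_K_antimono:
  assumes g: "g \<in> convex_cone_K" and st: "0 \<le> s" "s \<le> t"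
  shows "g t \<le> g s"
proof (rule ccontr)
  assume "\<not> g t \<le> g s"
  then have less: "g s < g t" "s < t" using st by (auto simp: order.order_iff_strict)
  have conv: "convex_on {0..} g" and nonneg: "\<And>t. 0 \<le> t \<Longrightarrow> 0 \<le> g t" and int: "set_integrable lborel {0..} g"
    using g by (auto simp: convex_cone_K_def)
  define \<kappa> where "\<kappa> = g t"
  have \<kappa>: "0 < \<kappa>" using less nonneg[OF st(1)] by (simp add: \<kappa>_def)
  have above: "\<kappa> \<le> g x" if "t \<le> x" for x
  proof -
    have "g t \<le> max (g s) (g x)"
      using st that by (intro convex_on_le_max_endpoints[OF conv]) auto
    then show ?thesis using less by (simp add: \<kappa>_def)
  qed
  define I where "I = (LBINT t:{0..}. g t)"
  have "0 \<le> I"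
    unfolding I_def using nonneg by (auto simp: set_lebesgue_integral_def indicator_def intro!: integral_nonneg)
  define L where "L = (I + 1) / \<kappa>"
  have L: "0 \<le> L" using \<kappa> \<open>0 \<le> I\<close> by (simp add: L_def)
  have "I + 1 = (LBINT x:{t..t + L}. \<kappa>)"
    using L \<kappa> by (simp add: set_lebesgue_integral_def L_def)
  also have "\<dots> \<le> (LBINT x:{t..t + L}. g x)"
    using above st by (intro set_integral_mono borel_integrable_atLeastAtMost' continuous_on_const
        set_integrable_subset[OF int]) auto
  also have "\<dots> \<le> I"
    unfolding I_def using st nonneg by (intro set_integral_subset_mono int) auto
  finally show False by simp
qed

lemma convex_cone_K_mult_integrable:
  assumes f: "f \<in> convex_cone_K" and g: "g \<in> convex_cone_K"
  shows "set_integrable lborel {0..} (\<lambda>t. f t * g t)"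
proof -
  have f': "continuous_on {0..} f" "\<And>t. 0 \<le> t \<Longrightarrow> 0 \<le> f t"
    and g': "continuous_on {0..} g" "\<And>t. 0 \<le> t \<Longrightarrow> 0 \<le> g t" "set_integrable lborel {0..} g"
    using f g by (auto simp: convex_cone_K_def)
  have "set_integrable lborel {0..} (\<lambda>t. f 0 * g t)"
    using g'(3) by (rule set_integrable_mult_right) 
  then show ?thesis
  proof (rule set_integrable_bound)
    show "set_borel_measurable lborel {0..} (\<lambda>t. f t * g t)"
      unfolding set_borel_measurable_def
      using borel_measurable_continuous_on_indicator[of "{0..}" "\<lambda>t. f t * g t"] f' g'
      by (auto intro: continuous_on_mult)
    show "AE t in lborel. t \<in> {0..} \<longrightarrow> norm (f t * g t) \<le> norm (f 0 * g t)"
      using f' g' convex_cone_K_antimono[OF f, of 0]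
      by (auto simp: abs_mult intro!: AE_I2 mult_right_mono)
  qed
qed

lemma convex_cone_K_convex_combination:
  assumes f: "f \<in> convex_cone_K" and g: "g \<in> convex_cone_K" and e: "0 \<le> e" "e \<le> 1"
  shows "(\<lambda>t. (1 - e) * f t + e * g t) \<in> convex_cone_K"
proof -
  note f' = f[unfolded convex_cone_K_def, simplified] and g' = g[unfolded convex_cone_K_def, simplified]
  have "convex_on {0..} (\<lambda>t. (1 - e) * f t + e * g t)"
    using f' g' e by (intro convex_on_add convex_on_cmul) auto
  moreover have "continuous_on {0..} (\<lambda>t. (1 - e) * f t + e * g t)"
    using f' g' by (intro continuous_on_add continuous_on_mult_left) auto
  moreover have "set_integrable lborel {0..} (\<lambda>t. (1 - e) * f t + e * g t)"
    using f' g' by (intro set_integral_add set_integrable_mult_right) auto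
  moreover have "0 \<le> (1 - e) * f t + e * g t" if "0 \<le> t" for t
    using f' g' e that by simp
  ultimately show ?thesis
    by (simp add: convex_cone_K_def)
qed

lemma linear_coefficient_nonneg:
  fixes A B :: real
  assumes "\<And>e. 0 < e \<Longrightarrow> e \<le> 1 \<Longrightarrow> 0 \<le> e * A + e\<^sup>2 * B"
  shows "0 \<le> A"
proof (rule tendsto_lowerbound)
  show "((\<lambda>e. A + e * B) \<longlongrightarrow> A) (at_right 0)"
    by (rule tendsto_eq_intros refl | simp)+
  show "\<forall>\<^sub>F e in at_right 0. 0 \<le> A + e * B"
    unfolding eventually_at_right[OF zero_less_one]
  proof (intro exI[of _ 1] conjI allI impI)
    fix e :: real assume e: "0 < e" "e < 1"
    have "e * (A + e * B) = e * A + e\<^sup>2 * B" by (simp add: power2_eq_square algebra_simps)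
    then have "0 \<le> e * (A + e * B)" using assms[of e] e by simp
    then show "0 \<le> A + e * B" using e by (simp add: zero_le_mult_iff)
  qed simp
qed simp

text \<open>
  The first-order condition at the minimiser \<open>f\<close>: the criterion is quadratic along the segment from
  \<open>f\<close> to \<open>g\<close>, which stays in the cone, so its derivative at \<open>f\<close> is nonnegative.
\<close>

lemma convex_lse_variational_inequality:
  assumes lse: "is_convex_lse n x f" and n: "0 < n" and x: "\<And>i. i < n \<Longrightarrow> 0 \<le> x i"
    and g: "g \<in> convex_cone_K"
  shows "(LBINT t:{0..}. f t * (f t - g t)) \<le> (\<Sum>i<n. f (x i) - g (x i)) / n"
proof -
  have f: "f \<in> convex_cone_K" and min: "\<And>k. k \<in> convex_cone_K \<Longrightarrow> lse_criterion n x f \<le> lse_criterion n x k"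
    using lse by (auto simp: is_convex_lse_def is_arg_min_linorder)
  note int = convex_cone_K_mult_integrable
  define A where "A = (\<Sum>i<n. f (x i) - g (x i)) / n - (LBINT t:{0..}. f t * (f t - g t))"
  define B where "B = (LBINT t:{0..}. (f t - g t)\<^sup>2) / 2"
  have crit: "lse_criterion n x k = 1 / 2 * (LBINT t:{0..}. (k t)\<^sup>2) - (\<Sum>i<n. k (x i)) / n"
    if "k \<in> convex_cone_K" for k
    using that by (intro lse_criterion_eq n x) (auto simp: convex_cone_K_def)
  have fd: "set_integrable lborel {0..} (\<lambda>t. f t * (f t - g t))"
    using set_integral_diff(1)[OF int[OF f f] int[OF f g]] by (simp add: algebra_simps)
  have gd: "set_integrable lborel {0..} (\<lambda>t. g t * (f t - g t))"
    using set_integral_diff(1)[OF int[OF g f] int[OF g g]] by (simp add: algebra_simps)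
  have dd: "set_integrable lborel {0..} (\<lambda>t. (f t - g t)\<^sup>2)"
    using set_integral_diff(1)[OF fd gd] by (simp add: algebra_simps power2_eq_square)
  have ff: "set_integrable lborel {0..} (\<lambda>t. (f t)\<^sup>2)"
    using int[OF f f] by (simp add: power2_eq_square)
  have "0 \<le> A"
  proof (rule linear_coefficient_nonneg)
    fix e :: real assume e: "0 < e" "e \<le> 1"
    let ?k = "\<lambda>t. (1 - e) * f t + e * g t"
    have k: "?k \<in> convex_cone_K"
      using e by (intro convex_cone_K_convex_combination f g) auto
    have sq: "(?k t)\<^sup>2 = (f t)\<^sup>2 + ((- 2 * e) * (f t * (f t - g t)) + e\<^sup>2 * (f t - g t)\<^sup>2)" for t
      by (simp add: power2_eq_square algebra_simps)
    have int_k: "(LBINT t:{0..}. (?k t)\<^sup>2) =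
          (LBINT t:{0..}. (f t)\<^sup>2) + ((- 2 * e) * (LBINT t:{0..}. f t * (f t - g t)) + e\<^sup>2 * (LBINT t:{0..}. (f t - g t)\<^sup>2))"
      unfolding sq
      by (simp only: set_integral_add set_integral_mult_right set_integrable_mult_right ff fd dd)
    have sum_k: "(\<Sum>i<n. ?k (x i)) = (\<Sum>i<n. f (x i)) - e * (\<Sum>i<n. f (x i) - g (x i))"
      by (simp add: sum.distrib sum_subtractf sum_distrib_left algebra_simps)
    have alg: "1 / 2 * (p + ((- 2 * e) * q + e\<^sup>2 * r)) - (s - e * w) / n =
        1 / 2 * p - s / n + (e * (w / n - q) + e\<^sup>2 * (r / 2))" for p q r s w
      by (simp add: diff_divide_distrib algebra_simps)
    have "lse_criterion n x ?k = lse_criterion n x f + (e * A + e\<^sup>2 * B)"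
      unfolding crit[OF k] crit[OF f] A_def B_def int_k sum_k
      by (rule alg)
    then show "0 \<le> e * A + e\<^sup>2 * B"
      using min[OF k] by simp
  qed
  then show ?thesis by (simp add: A_def)
qed

text \<open>
  The competitor \<open>g\<close> for which \<open>f - g\<close> is the frozen version of \<open>h\<close>. With \<open>2 * (1 - t)\<close> the
  line through the true density, \<open>g\<close> is this line plus the excesses of \<open>h\<close> over \<open>h a\<close> to the left
  of \<open>a\<close> and over \<open>h c\<close> to the right of \<open>c\<close>. Taken with their positive parts, these excesses are
  minimal at the cut points and thus remain convex when flattened on the inner side; as the
  cut points are minimisers of \<open>h\<close> on the outer sides, the positive parts change nothing on
  \<open>[0,1]\<close>. Beyond 1, where the line is negative, the positive part of the whole is taken, and
  \<open>0 \<le> h c\<close> keeps it below \<open>f\<close>.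
\<close>

lemma clamped_comparison_function:
  assumes f: "f \<in> convex_cone_K" and h: "h = (\<lambda>t. f t - 2 * (1 - t))"
    and ord: "0 \<le> a" "a \<le> c" "c \<le> 1"
    and left: "\<And>t. 0 \<le> t \<Longrightarrow> t \<le> a \<Longrightarrow> h a \<le> h t"
    and right: "\<And>t. c \<le> t \<Longrightarrow> t \<le> 1 \<Longrightarrow> h c \<le> h t" "0 \<le> h c"
  shows "\<exists>g\<in>convex_cone_K. (\<forall>t\<in>{0..1}. f t - g t = h (max a (min t c))) \<and> (\<forall>t>1. 0 \<le> g t \<and> g t \<le> f t)"
proof -
  define R where "R t = max 0 (h (max t c) - h c)" for t
  define L where "L t = max 0 (h (min t a) - h a)" for t
  define g where "g t = max 0 (2 * (1 - t) + (L t + R t))" for t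
  have f': "convex_on {0..} f" "continuous_on {0..} f" "\<And>t. 0 \<le> t \<Longrightarrow> 0 \<le> f t" "set_integrable lborel {0..} f"
    using f by (auto simp: convex_cone_K_def)
  have aff: "convex_on {0..} (\<lambda>t. \<alpha> + \<beta> * t)" for \<alpha> \<beta> :: real
    by (rule convex_onI) (auto simp: algebra_simps)
  have h_conv: "convex_on {0..} h"
    using convex_on_add[OF f'(1) aff[of "-2" 2]] by (simp add: h algebra_simps)
  have h_cont: "continuous_on {0..} h"
    unfolding h by (intro continuous_intros f')
  have excess: "convex_on {0..} (\<lambda>t. max 0 (h t - y))" for y
    by (intro convex_on_max_fun convex_on_diff h_conv) (auto simp: convex_on_const concave_on_const)
  have R_conv: "convex_on {0..} R"
    unfolding R_def by (rule convex_on_flatten_left[OF excess]) (use ord in auto)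
  have L_conv: "convex_on {0..} L"
    unfolding L_def by (rule convex_on_flatten_right[OF excess]) (use ord in auto)
  have g_conv: "convex_on {0..} g"
    unfolding g_def using aff[of 2 "-2"]
    by (intro convex_on_max_fun convex_on_add R_conv L_conv) (auto simp: convex_on_const algebra_simps)
  have g_cont: "continuous_on {0..} g"
    unfolding g_def L_def R_def using ord
    by (intro continuous_intros continuous_on_compose2[OF h_cont]) auto
  have eq: "f t - g t = h (max a (min t c))" if t: "t \<in> {0..1}" for t
  proof -
    consider "t \<le> a" | "a \<le> t" "t \<le> c" | "c \<le> t" by linarith
    then have "L t + R t = h t - h (max a (min t c))"
      using t ord left[of t] right(1)[of t]
      by cases (auto simp: L_def R_def max_def min_def)
    moreover have "0 \<le> L t + R t" by (simp add: L_def R_def)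
    ultimately show ?thesis using t by (simp add: g_def h)
  qed
  have tail: "0 \<le> g t \<and> g t \<le> f t" if "1 < t" for t
    using that ord f'(3)[of t] right(2) by (auto simp: g_def L_def R_def max_def h)
  have "set_integrable lborel {0..} g"
  proof -
    have "set_integrable lborel {0..1} g"
      using g_cont by (intro borel_integrable_atLeastAtMost') (auto intro: continuous_on_subset)
    moreover have "set_integrable lborel {1<..} g"
    proof (rule set_integrable_bound)
      show "set_integrable lborel {1<..} f"
        using f'(4) by (rule set_integrable_subset) auto
      have "continuous_on {1<..} g"
        using g_cont by (rule continuous_on_subset) auto
      then show "set_borel_measurable lborel {1<..} g"
        unfolding set_borel_measurable_def
        using borel_measurable_continuous_on_indicator[of "{1<..}" g] by simp
      have "norm (g t) \<le> norm (f t)" if "1 < t" for t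
        using tail[OF that] by simp
      then show "AE t in lborel. t \<in> {1<..} \<longrightarrow> norm (g t) \<le> norm (f t)"
        by simp
    qed
    ultimately have "set_integrable lborel ({0..1} \<union> {1<..}) g"
      by (rule set_integrable_Un) auto
    moreover have "{0..1} \<union> {1<..} = {0::real..}" by auto
    ultimately show ?thesis by simp
  qed
  then have "g \<in> convex_cone_K"
    using g_conv g_cont by (auto simp: convex_cone_K_def g_def)
  then show ?thesis using eq tail by blast
qed

section \<open>The triangular density\<close>

abbreviation triangular_law :: "real measure" where
  "triangular_law \<equiv> density lborel (\<lambda>t. ennreal (triangular_density t))"

lemma triangular_density_nonneg: "0 \<le> triangular_density t"
  by (simp add: triangular_density_def indicator_def)

lemma triangular_density_measurable[measurable]: "triangular_density \<in> borel_measurable borel"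
  unfolding triangular_density_def by measurable

lemma real_distribution_triangular_law: "real_distribution triangular_law"
proof -
  have "emeasure triangular_law (space triangular_law) = (\<integral>\<^sup>+t. ennreal (2 * (1 - t)) * indicator {0..1} t \<partial>lborel)"
    by (simp add: emeasure_density) (auto intro!: nn_integral_cong simp: triangular_density_def indicator_def)
  also have "\<dots> = ennreal ((2 * 1 - 1\<^sup>2) - (2 * 0 - 0\<^sup>2))"
    by (rule nn_integral_FTC_Icc[where F = "\<lambda>t. 2 * t - t\<^sup>2"])
       (auto intro!: derivative_eq_intros)
  finally have "prob_space triangular_law"
    by (intro prob_spaceI) simp
  then show ?thesis
    by (simp add: real_distribution_def real_distribution_axioms_def)
qed

lemma measure_triangular_law_singleton: "measure triangular_law {x} = 0"
proof -
  have "emeasure triangular_law {x} = 0"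
    by (subst emeasure_density) (auto intro!: nn_integral_null_set)
  then show ?thesis by (simp add: measure_def)
qed

lemma AE_triangular_law: "AE t in triangular_law. t \<in> {0..1}"
  by (subst AE_density) (auto simp: triangular_density_def indicator_def)

lemma integral_triangular_law:
  assumes [measurable]: "u \<in> borel_measurable borel"
  shows "(\<integral>t. u t \<partial>triangular_law) = (LBINT t:{0..1}. 2 * (1 - t) * u t)"
proof -
  have "(\<integral>t. u t \<partial>triangular_law) = (\<integral>t. triangular_density t *\<^sub>R u t \<partial>lborel)"
    by (rule integral_density) (auto simp: triangular_density_nonneg)
  then show ?thesis
    by (auto simp: set_lebesgue_integral_def triangular_density_def intro!: Bochner_Integration.integral_cong)
qed

text \<open>
  The deterministic heart of the matter: the error at \<open>x0\<close> is at most a constant multiple of the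
  distance between the empirical and the true distribution. Write \<open>I\<close> for the integral of \<open>u\<^sup>2\<close>,
  where \<open>u\<close> is the frozen error. The variational inequality with the competitor \<open>f - u\<close>
  gives \<open>I \<le> \<integral> u h \<le> \<integral> u d(P\<^sub>n - P)\<close>, which is at most \<open>4 * sup \<bar>u\<bar> * d\<close> since the sublevel sets of
  \<open>u\<close> are intervals. Together with \<open>\<delta> * (sup \<bar>u\<bar>)\<^sup>2 \<le> I\<close> one factor \<open>sup \<bar>u\<bar>\<close> cancels. As \<open>x0\<close>
  lies between the cut points, \<open>u x0\<close> is the error itself.
\<close>

lemma lse_pointwise_le_discrepancy:
  assumes lse: "is_convex_lse n x f" and n: "0 < n" and x: "\<And>i. i < n \<Longrightarrow> x i \<in> {0..1}"
    and x0: "0 < x0" "x0 < 1"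
    and d: "\<And>A t. A = {..t} \<or> A = {..<t} \<Longrightarrow>
        \<bar>(\<Sum>i<n. indicator A (x i)) / n - measure triangular_law A\<bar> \<le> d"
  shows "\<bar>f x0 - triangular_density x0\<bar> \<le> 4 / min (min (x0 / 2) ((1 - x0) / 2)) (1 / 16) * d"
proof -
  interpret T: real_distribution triangular_law by (rule real_distribution_triangular_law)
  \<comment> \<open>The cut points \<open>a \<le> b\<close> and \<open>m \<le> c\<close> must leave \<open>x0\<close> in between; \<open>\<delta>\<close> is the least of
    \<open>b\<close>, \<open>1 - m\<close> and \<open>(m - b) / 8\<close>, with \<open>m - b = 1 / 2\<close>.\<close>
  define \<delta> where "\<delta> = min (min (x0 / 2) ((1 - x0) / 2)) (1 / 16)"
  define b where "b = x0 / 2"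
  define m where "m = (1 + x0) / 2"
  have bm: "0 < b" "b < x0" "x0 < m" "m < 1" "m - b = 1 / 2"
    using x0 by (auto simp: b_def m_def field_simps)
  have m1: "(1 - x0) / 2 = 1 - m" by (simp add: m_def field_simps)
  have \<delta>: "0 < \<delta>" "\<delta> \<le> b" "\<delta> \<le> 1 - m" "\<delta> \<le> (m - b) / 8"
    using x0 bm unfolding \<delta>_def m1 b_def[symmetric] bm(5) by linarith+
  have d0: "0 \<le> d"
    using d[of "{..0}" 0] by (meson abs_ge_zero order_trans)
  have f: "f \<in> convex_cone_K"
    using lse by (simp add: is_convex_lse_def is_arg_min_def)
  note f' = f[unfolded convex_cone_K_def, simplified]
  define h where "h t = f t - 2 * (1 - t)" for t
  have conv: "convex_on {0..1} h"
  proof -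
    have "convex_on {0..1} f"
      using f' by (auto intro: convex_on_subset)
    moreover have "concave_on {0..1} (\<lambda>t::real. 2 * (1 - t))"
      by (auto simp: concave_on_iff algebra_simps)
    ultimately show ?thesis
      unfolding h_def by (rule convex_on_diff)
  qed
  have cont: "continuous_on {0..1} h"
    unfolding h_def using f' by (intro continuous_intros) (auto intro: continuous_on_subset)
  have b01: "0 \<le> b" "b \<le> 1" and m01: "0 \<le> m" "m \<le> 1"
    using bm by auto
  obtain a where a: "a \<in> {0..b}" "\<forall>t\<in>{0..a}. h a \<le> h t" "0 \<le> h a \<or> a = 0"
      "a = b \<or> h a \<le> 0 \<or> (\<forall>t\<in>{b..1}. h a \<le> h t)"
    using ex_left_cut_point[OF conv cont b01] by blast
  obtain c where c: "c \<in> {m..1}" "\<forall>t\<in>{c..1}. h c \<le> h t" "0 \<le> h c \<or> c = 1"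
      "c = m \<or> h c \<le> 0 \<or> (\<forall>t\<in>{0..m}. h c \<le> h t)"
    using ex_right_cut_point[OF conv cont m01] by blast
  have hc: "0 \<le> h c"
  proof (cases "c = 1")
    case True
    have "0 \<le> f 1" using f' by simp
    then show ?thesis by (simp add: True h_def)
  qed (use c(3) in auto)
  have ord: "0 \<le> a" "a \<le> b" "b < m" "m \<le> c" "c \<le> 1"
    using a(1) c(1) bm by auto
  define u where "u = (\<lambda>t. h (max a (min t c)))"
  have u_cont: "continuous_on S u" for S
    unfolding u_def using ord by (intro continuous_on_compose2[OF cont] continuous_intros) auto
  have u_meas[measurable]: "u \<in> borel_measurable borel"
    using u_cont by (rule borel_measurable_continuous_onI)
  define I where "I = (LBINT t:{0..1}. (u t)\<^sup>2)"
  have \<delta>_le: "\<delta> * (u t)\<^sup>2 \<le> I" for t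
    unfolding I_def
    by (rule clamped_convex_sup_le_L2[OF conv cont ord]) (use a c \<delta> bm in \<open>auto simp: u_def\<close>)
  \<comment> \<open>\<open>U\<close> plays the part of \<open>sup \<bar>u\<bar>\<close>, chosen such that \<open>I = \<delta> * U\<^sup>2\<close> holds exactly.\<close>
  define U where "U = sqrt (I / \<delta>)"
  have u_le: "\<bar>u t\<bar> \<le> U" for t
  proof -
    have "(u t)\<^sup>2 \<le> I / \<delta>"
      using \<delta>_le[of t] \<delta> by (simp add: pos_le_divide_eq mult.commute)
    then show ?thesis
      unfolding U_def by (intro real_le_rsqrt) simp
  qed
  have U0: "0 \<le> U" using u_le[of 0] by linarith
  have I_eq: "I = \<delta> * U\<^sup>2"
  proof -
    have "0 \<le> I"
      using \<delta>_le[of 0] \<delta> by (meson mult_nonneg_nonneg order_trans zero_le_power2 less_imp_le)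
    then show ?thesis using \<delta> by (simp add: U_def)
  qed
  have "\<exists>g\<in>convex_cone_K. (\<forall>t\<in>{0..1}. f t - g t = h (max a (min t c))) \<and> (\<forall>t>1. 0 \<le> g t \<and> g t \<le> f t)"
    by (rule clamped_comparison_function[OF f]) (use ord a c hc in \<open>auto simp: h_def\<close>)
  then obtain g where g: "g \<in> convex_cone_K" and fg: "\<And>t. t \<in> {0..1} \<Longrightarrow> f t - g t = u t"
    and tail: "\<And>t. 1 < t \<Longrightarrow> 0 \<le> g t \<and> g t \<le> f t"
    unfolding u_def by blast
  have int_all: "set_integrable lborel {0..} (\<lambda>t. f t * (f t - g t))"
    using set_integral_diff(1)[OF convex_cone_K_mult_integrable[OF f f] convex_cone_K_mult_integrable[OF f g]]
    by (simp add: algebra_simps)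
  have "(LBINT t:{0..1}. f t * u t) \<le> (LBINT t:{0..}. f t * (f t - g t))"
  proof -
    have "(LBINT t:{0..1} \<union> {1<..}. f t * (f t - g t)) =
        (LBINT t:{0..1}. f t * (f t - g t)) + (LBINT t:{1<..}. f t * (f t - g t))"
      by (intro set_integral_Un set_integrable_subset[OF int_all]) auto
    moreover have "{0..1} \<union> {1<..} = {0::real..}" by auto
    moreover have "0 \<le> (LBINT t:{1<..}. f t * (f t - g t))"
      unfolding set_lebesgue_integral_def
      using tail f' by (intro Bochner_Integration.integral_nonneg) (auto simp: indicator_def)
    moreover have "(LBINT t:{0..1}. f t * (f t - g t)) = (LBINT t:{0..1}. f t * u t)"
      using fg by (intro set_lebesgue_integral_cong) auto
    ultimately show ?thesis by simp
  qed
  also have "\<dots> \<le> (\<Sum>i<n. f (x i) - g (x i)) / n"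
    using x by (intro convex_lse_variational_inequality[OF lse n _ g]) auto
  also have "(\<Sum>i<n. f (x i) - g (x i)) = (\<Sum>i<n. u (x i))"
    using x by (intro sum.cong fg) auto
  finally have var: "(LBINT t:{0..1}. f t * u t) \<le> (\<Sum>i<n. u (x i)) / n" .
  \<comment> \<open>Where \<open>u\<close> differs from \<open>h\<close> it is a nonnegative constant below \<open>h\<close>.\<close>
  have "I \<le> (LBINT t:{0..1}. h t * u t)"
    unfolding I_def
  proof (intro set_integral_mono borel_integrable_atLeastAtMost' continuous_intros cont u_cont)
    fix t :: real assume t: "t \<in> {0..1}"
    consider "t < a" | "a \<le> t" "t \<le> c" | "c < t" by linarith
    then show "(u t)\<^sup>2 \<le> h t * u t"
    proof cases
      case 1
      then have "u t = h a" "0 \<le> h a" "h a \<le> h t"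
        using a ord t by (auto simp: u_def)
      then show ?thesis by (simp add: power2_eq_square mult_right_mono)
    next
      case 2
      then show ?thesis using ord by (simp add: u_def power2_eq_square)
    next
      case 3
      then have "u t = h c" "h c \<le> h t"
        using c ord t by (auto simp: u_def)
      then show ?thesis using hc by (simp add: power2_eq_square mult_right_mono)
    qed
  qed
  also have "\<dots> = (LBINT t:{0..1}. f t * u t) - (\<integral>t. u t \<partial>triangular_law)"
  proof -
    have "h t * u t = f t * u t - 2 * (1 - t) * u t" for t
      by (simp add: h_def algebra_simps)
    then have "(LBINT t:{0..1}. h t * u t) =
        (LBINT t:{0..1}. f t * u t) - (LBINT t:{0..1}. 2 * (1 - t) * u t)"
      using f' by (simp only:) (intro set_integral_diff borel_integrable_atLeastAtMost' continuous_intros u_cont,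
          auto intro: continuous_on_subset)
    then show ?thesis by (simp add: integral_triangular_law)
  qed
  also have "\<dots> \<le> (\<Sum>i<n. u (x i)) / n - (\<integral>t. u t \<partial>triangular_law)"
    using var by simp
  also have "\<dots> \<le> 2 * U * (2 * d)"
  proof -
    let ?P = "uniform_count_measure {..<n}"
    have P: "prob_space ?P"
      using n by (intro prob_space_uniform_count_measure) auto
    have int_P: "(\<integral>i. u (x i) \<partial>?P) = (\<Sum>i<n. u (x i)) / n"
      unfolding uniform_count_measure_def
      by (subst lebesgue_integral_point_measure_finite) (simp_all add: sum_divide_distrib)
    have "\<bar>(\<integral>i. u (x i) \<partial>?P) - (\<integral>t. u t \<partial>triangular_law)\<bar> \<le> 2 * U * (2 * d)"
    proof (rule expectation_diff_le_cdf_diff[OF P _ _ T.prob_space_axioms])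
      show "(\<lambda>i. u (x i)) \<in> borel_measurable ?P"
        by (simp add: measurable_def sets_uniform_count_measure space_uniform_count_measure)
      fix s
      obtain \<alpha> \<beta> where S: "{t\<in>{0..1}. u t \<le> s} = {\<alpha>..\<beta>}"
        using clamped_convex_sublevel[OF conv cont, of a c s] ord unfolding u_def by auto
      have "measure ?P {i \<in> space ?P. u (x i) \<le> s} = card {i\<in>{..<n}. x i \<in> {\<alpha>..\<beta>}} / n"
      proof -
        have "{i \<in> space ?P. u (x i) \<le> s} = {i\<in>{..<n}. x i \<in> {\<alpha>..\<beta>}}"
          unfolding S[symmetric] using x by (auto simp: space_uniform_count_measure)
        then show ?thesis
          by (simp only:) (subst measure_uniform_count_measure, auto)
      qed
      also have "real (card {i\<in>{..<n}. x i \<in> {\<alpha>..\<beta>}}) = (\<Sum>i<n. indicator {\<alpha>..\<beta>} (x i))"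
        by (simp add: indicator_def sum.If_cases Int_def)
      finally have mP: "measure ?P {i \<in> space ?P. u (x i) \<le> s} = (\<Sum>i<n. indicator {\<alpha>..\<beta>} (x i)) / n" .
      have mT: "measure triangular_law {t \<in> space triangular_law. u t \<le> s} = measure triangular_law {\<alpha>..\<beta>}"
        unfolding S[symmetric] using AE_triangular_law
        by (intro T.finite_measure_eq_AE) auto
      show "\<bar>measure ?P {i \<in> space ?P. u (x i) \<le> s} - measure triangular_law {t \<in> space triangular_law. u t \<le> s}\<bar> \<le> 2 * d"
      proof (cases "\<alpha> \<le> \<beta>")
        case True
        have "indicat_real {\<alpha>..\<beta>} y = indicator {..\<beta>} y - indicator {..<\<alpha>} y" for y
          using True by (auto simp: indicator_def)
        then have e1: "(\<Sum>i<n. indicat_real {\<alpha>..\<beta>} (x i)) / n =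
            (\<Sum>i<n. indicator {..\<beta>} (x i)) / n - (\<Sum>i<n. indicator {..<\<alpha>} (x i)) / n"
          by (simp add: sum_subtractf diff_divide_distrib)
        have eq: "{\<alpha>..\<beta>} = {..\<beta>} - {..<\<alpha>}" by auto
        have e2: "measure triangular_law {\<alpha>..\<beta>} = measure triangular_law {..\<beta>} - measure triangular_law {..<\<alpha>}"
          unfolding eq by (rule T.finite_measure_Diff) (use True in auto)
        have "\<bar>(p - q) - (p' - q')\<bar> \<le> 2 * d" if "\<bar>p - p'\<bar> \<le> d" "\<bar>q - q'\<bar> \<le> d" for p q p' q' :: real
          using that by linarith
        then show ?thesis
          unfolding mP mT e1 e2 using d[of "{..\<beta>}" \<beta>] d[of "{..<\<alpha>}" \<alpha>] by blast
      next
        case False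
        then show ?thesis unfolding mP mT using d0 by simp
      qed
    qed (use u_le in auto)
    then show ?thesis unfolding int_P by linarith
  qed
  finally have "\<delta> * U\<^sup>2 \<le> 2 * U * (2 * d)"
    unfolding I_eq .
  then have "U * (\<delta> * U) \<le> U * (4 * d)"
    by (simp add: power2_eq_square mult_ac)
  then have "\<delta> * U \<le> 4 * d"
    using U0 d0 by (cases "U = 0") auto
  then have "U \<le> 4 / \<delta> * d"
    using \<delta> by (simp add: pos_le_divide_eq mult.commute)
  moreover have "f x0 - triangular_density x0 = u x0"
    using x0 ord bm by (simp add: u_def h_def triangular_density_def)
  ultimately show ?thesis
    using u_le[of x0] unfolding \<delta>_def by linarith
qed

theorem theorem2p1:
  fixes M :: "'a measure" and X :: "nat \<Rightarrow> 'a \<Rightarrow> real"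
    and fhat :: "nat \<Rightarrow> 'a \<Rightarrow> real \<Rightarrow> real" and x0 :: real
  assumes "prob_space M"
    and "prob_space.indep_vars M (\<lambda>_. borel) X UNIV"
    and "\<And>i. distributed M lborel (X i) (\<lambda>t. ennreal (triangular_density t))"
    and "\<And>n. n \<ge> 1 \<Longrightarrow> AE \<omega> in M. is_convex_lse n (\<lambda>i. X i \<omega>) (fhat n \<omega>)"
    and "0 < x0" "x0 < 1"
  shows "bigO_in_prob M (\<lambda>n \<omega>. \<bar>fhat n \<omega> x0 - triangular_density x0\<bar>)
           (\<lambda>n. real n powr (- 1 / 2))"
  unfolding bigO_in_prob_def
proof (intro allI impI)
  fix \<epsilon> :: real assume \<epsilon>: "0 < \<epsilon>"
  interpret prob_space M by fact
  have [measurable]: "X i \<in> borel_measurable M" for i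
    using distributed_measurable[OF assms(3)[of i]] by simp
  have law: "distr M borel (X i) = triangular_law" for i
  proof -
    have "distr M borel (X i) = distr M lborel (X i)"
      by (rule distr_cong) auto
    then show ?thesis
      using distributed_distr_eq_density[OF assms(3)[of i]] by simp
  qed
  have range: "AE \<omega> in M. X i \<omega> \<in> {0..1}" for i
  proof -
    have "AE t in distr M borel (X i). t \<in> {0..1}"
      unfolding law by (rule AE_triangular_law)
    then show ?thesis by (subst (asm) AE_distr_iff) auto
  qed
  define K where "K = 4 / min (min (x0 / 2) ((1 - x0) / 2)) (1 / 16)"
  have K: "0 < K" using assms(5,6) by (simp add: K_def)
  \<comment> \<open>This makes the probability bound \<open>2 / l\<^sup>2\<close> of the exceptional event equal to \<open>\<epsilon>\<close>.\<close>
  define l where "l = sqrt (2 / \<epsilon>)"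
  have l: "0 < l" "2 / l\<^sup>2 = \<epsilon>" using \<epsilon> by (auto simp: l_def)
  have "outer_measure_of M {\<omega> \<in> space M.
      \<bar>\<bar>fhat n \<omega> x0 - triangular_density x0\<bar>\<bar> > K * (l + 1) * real n powr (- 1 / 2)} \<le> ennreal \<epsilon>"
    (is "outer_measure_of M ?A \<le> _") if n: "1 \<le> n" for n
  proof -
    have "indep_vars (\<lambda>_. borel) X {..<n}"
      using assms(2) by (rule indep_vars_subset) auto
    from uniform_empirical_deviation[OF this _ l(1) real_distribution_triangular_law law measure_triangular_law_singleton]
    obtain E where E: "E \<in> events" "prob E \<le> \<epsilon>"
      and dev: "\<And>\<omega> A t. \<omega> \<in> space M - E \<Longrightarrow> A = {..t::real} \<or> A = {..<t} \<Longrightarrow>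
        \<bar>(\<Sum>i<n. indicator A (X i \<omega>)) / n - measure triangular_law A\<bar> \<le> l / sqrt n + 1 / n"
      using n unfolding l(2) by auto
    have "AE \<omega> in M. is_convex_lse n (\<lambda>i. X i \<omega>) (fhat n \<omega>) \<and> (\<forall>i. X i \<omega> \<in> {0..1})"
      using assms(4)[OF n] range by (simp add: AE_conj_iff AE_all_countable)
    then obtain N where N: "N \<in> null_sets M"
      "{\<omega> \<in> space M. \<not> (is_convex_lse n (\<lambda>i. X i \<omega>) (fhat n \<omega>) \<and> (\<forall>i. X i \<omega> \<in> {0..1}))} \<subseteq> N"
      unfolding eventually_ae_filter by auto
    have root: "real n powr (- 1 / 2) = 1 / sqrt n"
      using n by (simp add: powr_minus_divide powr_half_sqrt)
    have rate: "l / sqrt n + 1 / n \<le> (l + 1) * real n powr (- 1 / 2)"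
    proof -
      have "1 * sqrt n \<le> sqrt n * sqrt n"
        using n by (intro mult_right_mono) auto
      then have "1 / real n \<le> 1 / sqrt n"
        using n by (intro divide_left_mono) auto
      then show ?thesis unfolding root by (simp add: add_divide_distrib)
    qed
    have "?A \<subseteq> E \<union> N"
    proof (rule subsetI, rule ccontr)
      fix \<omega> assume \<omega>: "\<omega> \<in> ?A" "\<omega> \<notin> E \<union> N"
      then have "is_convex_lse n (\<lambda>i. X i \<omega>) (fhat n \<omega>)" "\<And>i. X i \<omega> \<in> {0..1}"
        using N(2) by auto
      then have "\<bar>fhat n \<omega> x0 - triangular_density x0\<bar> \<le> K * (l / sqrt n + 1 / n)"
        unfolding K_def using dev[of \<omega>] \<omega> n assms(5,6)
        by (intro lse_pointwise_le_discrepancy[of n "\<lambda>i. X i \<omega>"]) auto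
      also have "\<dots> \<le> K * ((l + 1) * real n powr (- 1 / 2))"
        using K rate by (intro mult_left_mono) auto
      finally show False using \<omega>(1) by (simp add: mult.assoc)
    qed
    then have "outer_measure_of M ?A \<le> emeasure M (E \<union> N)"
      unfolding outer_measure_of_def using E N by (intro INF_lower) auto
    also have "\<dots> = emeasure M E"
      using E N by (intro emeasure_Un_null_set) auto
    also have "\<dots> \<le> ennreal \<epsilon>"
      using E \<epsilon> by (simp add: emeasure_eq_measure)
    finally show ?thesis .
  qed
  then show "\<exists>C. \<forall>\<^sub>F n in sequentially. outer_measure_of M {\<omega> \<in> space M.
      \<bar>\<bar>fhat n \<omega> x0 - triangular_density x0\<bar>\<bar> > C * real n powr (- 1 / 2)} \<le> ennreal \<epsilon>"
    by (intro exI[of _ "K * (l + 1)"] eventually_sequentiallyI[of 1])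
qed

end
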